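(* Let $\varphi$ be the Weyl function of the Dirac system $\frac{d}{dx}u(x,z)=i\big(zj+jV(x)\big)u(x,z)$, $x\ge0$, whose $p\times p$ measurable potential $v$ is locally bounded, that is, $\sup_{0<x<l}\|v(x)\|<\infty$ for every $l>0$. For $n\in\mathbb N_0$, $0\le q\le n$, put $$a_{nq}=\frac{(-1)^q(n+q)!}{(q!)^2(n-q)!},\qquad c_n(\lambda)=\frac{(2n+1)\prod_{q=1}^n\big(q-\frac12+i\lambda\big)}{\prod_{q=0}^n\big(q+\frac12-i\lambda\big)}.$$ Then for any $\varepsilon>0$ and $\Im z>\frac12+\varepsilon$ the matrix function $\varphi$ admits the representation $$\varphi(z)=-z^2\sum_{n=0}^\infty c_n\Big(z+\frac i2-i\varepsilon\Big)\sum_{q=0}^n(q+\varepsilon)^{-2}a_{nq}\,\varphi(iq+i\varepsilon).$$ Moreover, for $\Im z>\frac12+\varepsilon$, $$\Big\|\varphi(z)+z^2\sum_{n=0}^Nc_n\Big(z+\frac i2-i\varepsilon\Big)\sum_{q=0}^n(q+\varepsilon)^{-2}a_{nq}\,\varphi(iq+i\varepsilon)\Big\|=O\Big(N^{\frac12+\varepsilon-\Im z}\Big),\qquad N\to\infty.$$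
   Context: Here $j=\begin{bmatrix} I_p&0\\0&-I_p\end{bmatrix}$, $V=\begin{bmatrix}0&v\\ v^*&0\end{bmatrix}$. Let $\widehat u(x,z)$ be the fundamental solution of the Dirac system normalized by $\widehat u(0,z)=\frac{1}{\sqrt2}\begin{bmatrix} I_p& I_p\\ -I_p&I_p\end{bmatrix}$. The Weyl function of the system is the (unique) $p\times p$ matrix function $\varphi(z)$, $z\in\mathbb C_+$ (the open upper half-plane), such that $$\int_0^\infty [\,I_p\ \ i\varphi(z)^*\,]\,\widehat u(x,z)^*\widehat u(x,z)\begin{bmatrix} I_p\\ -i\varphi(z)\end{bmatrix}dx<\infty\qquad (z\in\mathbb C_+).$$ $\mathbb N_0$ is the set of non-negative integers. *)

theory Defs
  imports "HOL-Analysis.Analysis" "HOL-Library.Landau_Symbols"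
begin

text \<open>A $p \times p$ matrix is an element of \<^typ>\<open>complex^'p^'p\<close>; the $2p$-dimensional objects are
  indexed by \<^typ>\<open>'p + 'p\<close>, where \<^const>\<open>Inl\<close> and \<^const>\<open>Inr\<close> select the first and the second block.
  The library norm on matrices is the Frobenius norm; since dimensions are finite, neither local
  boundedness nor the $O$-estimate depends on this choice.\<close>

definition cscale :: "complex \<Rightarrow> complex^'n^'m \<Rightarrow> complex^'n^'m" (infixr "*\<^sub>C" 75)
  where "c *\<^sub>C A = map_matrix (\<lambda>x. c * x) A"

definition conj_transpose :: "complex^'n^'m \<Rightarrow> complex^'m^'n"
  where "conj_transpose A = transpose (map_matrix cnj A)"

definition block_row :: "'a^'n^'m \<Rightarrow> 'a^'k^'m \<Rightarrow> 'a^('n + 'k)^'m"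
  where "block_row A B = (\<chi> i j. case j of Inl l \<Rightarrow> A $ i $ l | Inr r \<Rightarrow> B $ i $ r)"

definition block_col :: "'a^'n^'m \<Rightarrow> 'a^'n^'k \<Rightarrow> 'a^'n^('m + 'k)"
  where "block_col A B = (\<chi> i. case i of Inl l \<Rightarrow> A $ l | Inr r \<Rightarrow> B $ r)"

definition block_mat ::
    "'a^'n^'m \<Rightarrow> 'a^'k^'m \<Rightarrow> 'a^'n^'l \<Rightarrow> 'a^'k^'l \<Rightarrow> 'a^('n + 'k)^('m + 'l)"
  where "block_mat A B C D = block_col (block_row A B) (block_row C D)"

definition dirac_j :: "complex^('p::finite + 'p)^('p + 'p)"
  where "dirac_j = block_mat (mat 1) 0 0 (- mat 1)"

definition dirac_V :: "complex^'p^'p \<Rightarrow> complex^('p::finite + 'p)^('p + 'p)"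
  where "dirac_V w = block_mat 0 w (conj_transpose w) 0"

definition absolutely_continuous_on_interval ::
    "real \<Rightarrow> real \<Rightarrow> (real \<Rightarrow> 'a::real_normed_vector) \<Rightarrow> bool"
  where "absolutely_continuous_on_interval a b f \<longleftrightarrow>
    (\<forall>e>0. \<exists>d>0. \<forall>S. finite S \<and> S \<subseteq> {(s, t). a \<le> s \<and> s \<le> t \<and> t \<le> b} \<and>
        disjoint_family_on (\<lambda>(s, t). {s<..<t}) S \<and> (\<Sum>(s, t)\<in>S. t - s) < d \<longrightarrow>
        (\<Sum>(s, t)\<in>S. norm (f t - f s)) < e)"

text \<open>As the potential is merely measurable, solutions are understood in the sense of
  Caratheodory: locally absolutely continuous on $[0,\infty)$, with the differential equation
  holding almost everywhere.\<close>

definition dirac_solution ::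
    "(real \<Rightarrow> complex^'p^'p) \<Rightarrow> complex \<Rightarrow> (real \<Rightarrow> complex^('p::finite + 'p)^('p + 'p)) \<Rightarrow> bool"
  where "dirac_solution v z u \<longleftrightarrow>
    (\<forall>l>0. absolutely_continuous_on_interval 0 l u) \<and>
    (AE x in lebesgue. x > 0 \<longrightarrow>
      (u has_vector_derivative
        (\<i> *\<^sub>C ((z *\<^sub>C dirac_j + dirac_j ** dirac_V (v x)) ** u x))) (at x))"

definition normalized_fundamental_solution ::
    "(real \<Rightarrow> complex^'p^'p) \<Rightarrow> (real \<Rightarrow> complex \<Rightarrow> complex^('p::finite + 'p)^('p + 'p)) \<Rightarrow> bool"
  where "normalized_fundamental_solution v u \<longleftrightarrow>
    (\<forall>z. dirac_solution v z (\<lambda>x. u x z) \<and>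
         u 0 z = (1 / sqrt 2) *\<^sub>R block_mat (mat 1) (mat 1) (- mat 1) (mat 1))"

text \<open>For locally bounded potentials the normalized fundamental solution exists and is unique, so the
  existential quantifier below only names it. The integrand is positive semidefinite, so finiteness
  of the matrix integral is absolute (Lebesgue) integrability. Only the values of the
  function on the open upper half-plane are constrained.\<close>

definition weyl_function ::
    "(real \<Rightarrow> complex^'p^'p) \<Rightarrow> (complex \<Rightarrow> complex^'p^'p) \<Rightarrow> bool"
  where "weyl_function v \<phi> \<longleftrightarrow>
    (\<exists>u. normalized_fundamental_solution v u \<and>
      (\<forall>z. Im z > 0 \<longrightarrow>
        (\<lambda>x. block_row (mat 1) (\<i> *\<^sub>C conj_transpose (\<phi> z)) ** conj_transpose (u x z) ** u x z
              ** block_col (mat 1) (- (\<i> *\<^sub>C \<phi> z))) absolutely_integrable_on {0..}))"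

definition a_coeff :: "nat \<Rightarrow> nat \<Rightarrow> real"
  where "a_coeff n q = (-1) ^ q * fact (n + q) / ((fact q)\<^sup>2 * fact (n - q))"

definition c_coeff :: "nat \<Rightarrow> complex \<Rightarrow> complex"
  where "c_coeff n w =
    (2 * of_nat n + 1) * (\<Prod>q=1..n. of_nat q - 1/2 + \<i> * w) / (\<Prod>q=0..n. of_nat q + 1/2 - \<i> * w)"

definition weyl_series_term :: "(complex \<Rightarrow> complex^'p^'p) \<Rightarrow> real \<Rightarrow> complex \<Rightarrow> nat \<Rightarrow> complex^'p^'p"
  where "weyl_series_term \<phi> \<epsilon> z n =
    c_coeff n (z + \<i> / 2 - \<i> * complex_of_real \<epsilon>) *\<^sub>C
      (\<Sum>q=0..n. ((real q + \<epsilon>) powi (-2) * a_coeff n q) *\<^sub>R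
          \<phi> (\<i> * of_nat q + \<i> * complex_of_real \<epsilon>))"

end

theory Submission
  imports Defs "HOL-Complex_Analysis.Complex_Analysis"
begin

text \<open>Put \<zeta>_q = i (q + \<epsilon>), s = 1 - i z - \<epsilon> and F(\<zeta>) = \<phi>(\<zeta>) / \<zeta>^2. As \<zeta>_q^2 = - (q + \<epsilon>)^2, the partial sums of the
  series differ from \<phi>(z) by z^2 times the remainder
    L_N(F) = F(z) - (\<Sum>n\<le>N. c_n (\<Sum>q\<le>n. a_nq F(\<zeta>_q))),
  so the whole theorem is the bound L_N(F) = O(N^(1/2 + \<epsilon> - Im z)), whose exponent is negative.

  The functional L_N is explicit on Cauchy kernels. With B_n(b) the product of (q + 1 - b) / (q + b) over
  q < n, the partial fraction expansion of B_n(b) / (n + b) has the coefficients a_nq, and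
  c_n = (2 n + 1) B_n(s) / (n + s). Therefore the sum over n telescopes, and
    L_N(1 / (\<zeta> - p)) = B_(N+1)(s) B_(N+1)(\<epsilon> + i p) / (z - p)
  (lemmas \<open>a_coeff_partial_fractions\<close>, \<open>blaschke_telescope\<close>, \<open>sampling_error_cauchy_kernel\<close>). The first factor
  decays like N^(1 - 2 Re s) by the asymptotics of the Gamma function, and the second one is at most of order
  N, uniformly in a half-plane Im p \<le> \<delta> with \<delta> > 0. By Cauchy's estimates in this half-plane the same
  decay holds, uniformly in real t, for the kernels (1 + t \<zeta>) / ((t - \<zeta>) \<zeta>^2), which have a double pole at 0
  (lemma \<open>sampling_error_kernels_decay\<close>).

  Together with 1 / \<zeta>^2 these kernels generate all functions f(\<zeta>) / \<zeta>^2 with f analytic in the upper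
  half-plane and Im f \<ge> 0. In the coordinates of the unit disc, the Schwarz integral formula for a dilation of f writes it as an average
  of the kernels against a positive density whose mass is bounded independently of the dilation. As L_N
  involves finitely many points of the open half-plane only, the dilation parameter can tend to 1
  (lemma \<open>norm_sampling_error_nevanlinna_le\<close>).

  It remains to see that \<xi>^* \<phi>(\<zeta>) \<xi> is such a function for every vector \<xi>. Let y_\<zeta>(x) be the square integrable
  solution u(x, \<zeta>) [I; - i \<phi>(\<zeta>)] \<xi>. The derivative of y_w^* j y_\<zeta> is i (\<zeta> - cnj w) y_w^* y_\<zeta>, the form vanishes at
  infinity, and its value at 0 is given by the normalization of u. Integration over the half-line gives
    (\<zeta> - cnj w) <y_\<zeta>, y_w> = f(\<zeta>) - cnj (f(w)) for f(\<zeta>) = \<xi>^* \<phi>(\<zeta>) \<xi>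
  (lemma \<open>dirac_kernel_identity\<close>). For w = \<zeta> this is Im f \<ge> 0. Analyticity of f is a consequence
  of the same identity, since it makes (y_\<zeta> - y_w) / (\<zeta> - w) behave like the resolvent of a symmetric
  operator applied to y_w (lemma \<open>nevanlinna_kernel_imp_holomorphic\<close>).
  Polarization recovers the entries of \<phi> from the quadratic forms.\<close>

section \<open>Blaschke products and partial fractions\<close>

text \<open>This is the finite Blaschke product of the half-plane Re b > 1/2 with zeros 1, ..., n; its poles
  0, -1, ..., 1 - n are the mirror images of the zeros in the line Re b = 1/2.\<close>

definition blaschke :: "nat \<Rightarrow> complex \<Rightarrow> complex"
  where "blaschke n b = (\<Prod>q<n. (of_nat q + 1 - b) / (of_nat q + b))"

lemma prod_shift_fact: "(\<Prod>q<n. of_nat q + 1 + of_nat j) = (fact (n + j) / fact j :: complex)"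
  by (induction n) (auto simp: algebra_simps)

lemma prod_except_fact:
  assumes "j \<le> n"
  shows "(\<Prod>k\<in>{0..n} - {j}. of_nat k - of_nat j) = ((-1) ^ j * fact j * fact (n - j) :: complex)"
proof -
  have split: "{0..n} - {j} = {..<j} \<union> {j<..n}" using assms by auto
  have "(\<Prod>k<j. of_nat k - of_nat j) = (\<Prod>k<j. of_nat (Suc k) * (-1) :: complex)"
    by (rule prod.reindex_bij_witness[of _ "\<lambda>k. j - Suc k" "\<lambda>k. j - Suc k"]) (auto simp: of_nat_diff)
  also have "\<dots> = (-1) ^ j * fact j"
    by (subst prod.distrib) (simp add: fact_prod_Suc atLeast0LessThan del: of_nat_Suc)
  finally have left: "(\<Prod>k<j. of_nat k - of_nat j) = ((-1) ^ j * fact j :: complex)" .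
  have "(\<Prod>k\<in>{j<..n}. of_nat k - of_nat j) = (\<Prod>k<n - j. of_nat (Suc k) :: complex)"
    by (rule prod.reindex_bij_witness[of _ "\<lambda>k. k + Suc j" "\<lambda>k. k - Suc j"]) (auto simp: of_nat_diff)
  also have "\<dots> = fact (n - j)"
    by (simp add: fact_prod_Suc atLeast0LessThan del: of_nat_Suc)
  finally have right: "(\<Prod>k\<in>{j<..n}. of_nat k - of_nat j) = (fact (n - j) :: complex)" .
  show ?thesis
    unfolding split by (subst prod.union_disjoint) (auto simp: left right)
qed

text \<open>Both sides are polynomials in b of degree at most n. At b = - j only the summand q = j survives on the left,
  and a_nj is precisely the number that makes the two values agree, so the sides agree at n + 1 points.\<close>

lemma a_coeff_partial_fractions_poly:
  "(\<Sum>q=0..n. of_real (a_coeff n q) * (\<Prod>k\<in>{0..n} - {q}. of_nat k + b))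
     = (\<Prod>q<n. of_nat q + 1 - b :: complex)"
proof -
  define P :: "complex poly" where
    "P = (\<Sum>q=0..n. smult (of_real (a_coeff n q)) (\<Prod>k\<in>{0..n} - {q}. [:of_nat k, 1:]))"
  define R :: "complex poly" where "R = (\<Prod>q<n. [:of_nat q + 1, -1:])"
  have degP: "degree P \<le> n"
    unfolding P_def
  proof (rule degree_sum_le)
    fix q assume q: "q \<in> {0..n}"
    have "degree (\<Prod>k\<in>{0..n} - {q}. [:of_nat k, 1 :: complex:]) = (\<Sum>k\<in>{0..n} - {q}. 1)"
      by (subst degree_prod_eq_sum_degree) auto
    also have "\<dots> = n" using q by simp
    finally show "degree (smult (of_real (a_coeff n q)) (\<Prod>k\<in>{0..n} - {q}. [:of_nat k, 1 :: complex:])) \<le> n"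
      by (metis degree_smult_le)
  qed auto
  have degR: "degree R \<le> n"
    unfolding R_def by (subst degree_prod_eq_sum_degree) auto
  define A where "A = (\<lambda>j. - of_nat j :: complex) ` {0..n}"
  have cardA: "card A = n + 1"
    unfolding A_def by (subst card_image) (auto simp: inj_on_def)
  have "P = R"
  proof (rule poly_eqI_degree[of A])
    show "card A > degree P" "card A > degree R" using cardA degP degR by auto
    fix x assume "x \<in> A"
    then obtain j where j: "j \<le> n" and x: "x = - of_nat j" by (auto simp: A_def)
    have "poly P x = (\<Sum>q=0..n. of_real (a_coeff n q) * (\<Prod>k\<in>{0..n} - {q}. of_nat k - of_nat j))"
      by (simp add: P_def poly_sum poly_prod x)
    also have "\<dots> = (\<Sum>q=0..n. if q = j then of_real (a_coeff n q) * (\<Prod>k\<in>{0..n} - {q}. of_nat k - of_nat j) else 0)"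
      by (intro sum.cong refl) (use j in auto)
    also have "\<dots> = of_real (a_coeff n j) * (\<Prod>k\<in>{0..n} - {j}. of_nat k - of_nat j)"
      using j by simp
    also have "\<dots> = fact (n + j) / fact j"
      by (subst prod_except_fact[OF j]) (simp add: a_coeff_def power2_eq_square)
    also have "\<dots> = poly R x"
      by (simp add: R_def poly_prod x prod_shift_fact)
    finally show "poly P x = poly R x" .
  qed
  then have "poly P b = poly R b" by simp
  then show ?thesis by (simp add: P_def R_def poly_sum poly_prod)
qed

lemma a_coeff_partial_fractions:
  assumes "\<And>q. q \<le> n \<Longrightarrow> of_nat q + b \<noteq> (0 :: complex)"
  shows "(\<Sum>q=0..n. of_real (a_coeff n q) / (of_nat q + b)) = blaschke n b / (of_nat n + b)"
proof -
  have nz: "(\<Prod>k\<in>{0..n}. of_nat k + b) \<noteq> 0" using assms by simp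
  have "(\<Sum>q=0..n. of_real (a_coeff n q) / (of_nat q + b))
      = (\<Sum>q=0..n. of_real (a_coeff n q) * (\<Prod>k\<in>{0..n} - {q}. of_nat k + b) / (\<Prod>k\<in>{0..n}. of_nat k + b))"
  proof (intro sum.cong refl)
    fix q assume q: "q \<in> {0..n}"
    have "(\<Prod>k\<in>{0..n}. of_nat k + b) = (of_nat q + b) * (\<Prod>k\<in>{0..n} - {q}. of_nat k + b)"
      using q by (intro prod.remove) auto
    then show "of_real (a_coeff n q) / (of_nat q + b)
      = of_real (a_coeff n q) * (\<Prod>k\<in>{0..n} - {q}. of_nat k + b) / (\<Prod>k\<in>{0..n}. of_nat k + b)"
      using nz by (auto simp: divide_simps)
  qed
  also have "\<dots> = (\<Prod>q<n. of_nat q + 1 - b) / (\<Prod>k\<in>{0..n}. of_nat k + b)"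
    by (simp add: a_coeff_partial_fractions_poly flip: sum_divide_distrib)
  also have "(\<Prod>k\<in>{0..n}. of_nat k + b) = (\<Prod>k<n. of_nat k + b) * (of_nat n + b)"
    by (simp add: atLeast0AtMost lessThan_Suc_atMost[symmetric])
  finally show ?thesis by (simp add: blaschke_def prod_dividef)
qed

text \<open>The n-th summand times s + b - 1 is the decrease of B(s) B(b) from n to n + 1, because
  (n + s) (n + b) - (n + 1 - s) (n + 1 - b) = (2 n + 1) (s + b - 1).\<close>

lemma blaschke_telescope:
  assumes "\<And>q. q < N \<Longrightarrow> of_nat q + s \<noteq> 0" "\<And>q. q < N \<Longrightarrow> of_nat q + b \<noteq> 0"
  shows "(s + b - 1) * (\<Sum>n<N. (2 * of_nat n + 1) * (blaschke n s / (of_nat n + s)) * (blaschke n b / (of_nat n + b)))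
     = 1 - blaschke N s * blaschke N b"
  using assms
proof (induction N)
  case 0
  show ?case by (simp add: blaschke_def)
next
  case (Suc N)
  have nz: "of_nat N + s \<noteq> 0" "of_nat N + b \<noteq> 0" using Suc.prems by auto
  have step: "blaschke (Suc N) x = blaschke N x * ((of_nat N + 1 - x) / (of_nat N + x))" for x
    by (simp add: blaschke_def)
  have "(s + b - 1) * ((2 * of_nat N + 1) * (blaschke N s / (of_nat N + s)) * (blaschke N b / (of_nat N + b)))
      = blaschke N s * blaschke N b - blaschke (Suc N) s * blaschke (Suc N) b"
    unfolding step using nz by (simp add: divide_simps) algebra
  moreover have "(s + b - 1) * (\<Sum>n<N. (2 * of_nat n + 1) * (blaschke n s / (of_nat n + s)) * (blaschke n b / (of_nat n + b)))
     = 1 - blaschke N s * blaschke N b"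
    by (rule Suc.IH) (use Suc.prems in auto)
  ultimately show ?case by (simp add: distrib_left)
qed

text \<open>The product is a quotient of Pochhammer symbols, hence n^(1 - 2 b) times a quotient of the
  convergent products that approximate 1 / Gamma(1 - b) and 1 / Gamma(b). With 1 / Gamma in place of Gamma the
  integers b > 0, where the product is eventually 0, need no separate treatment.\<close>

lemma blaschke_bigo:
  assumes "Re b > 0"
  shows "(\<lambda>N. norm (blaschke (Suc N) b)) \<in> O(\<lambda>N. real N powr (1 - 2 * Re b))"
proof -
  have nz: "of_nat q + b \<noteq> 0" for q using assms by (auto simp: complex_eq_iff)
  have "rGamma_series (1 - b) \<longlonglongrightarrow> rGamma (1 - b)" by (rule rGamma_series_LIMSEQ)
  moreover have "rGamma_series b \<longlonglongrightarrow> rGamma b" by (rule rGamma_series_LIMSEQ)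
  moreover have "rGamma b \<noteq> 0"
    using assms by (auto simp: rGamma_eq_zero_iff elim!: nonpos_Ints_cases')
  ultimately have "(\<lambda>N. rGamma_series (1 - b) N / rGamma_series b N) \<longlonglongrightarrow> rGamma (1 - b) / rGamma b"
    by (intro tendsto_divide)
  then have "Bseq (\<lambda>N. rGamma_series (1 - b) N / rGamma_series b N)"
    by (intro convergent_imp_Bseq) (auto simp: convergent_def)
  then obtain K where K: "\<And>N. norm (rGamma_series (1 - b) N / rGamma_series b N) \<le> K"
    by (auto simp: Bseq_def)
  have "norm (blaschke (Suc N) b) \<le> K * real N powr (1 - 2 * Re b)" if "N > 0" for N
  proof -
    have "blaschke (Suc N) b = pochhammer (1 - b) (N + 1) / pochhammer b (N + 1)"
      by (simp add: blaschke_def prod_dividef pochhammer_prod atLeast0LessThan algebra_simps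
          del: prod.lessThan_Suc)
    also have "\<dots> = (rGamma_series (1 - b) N / rGamma_series b N)
        * (exp ((1 - b) * of_real (ln (of_nat N))) / exp (b * of_real (ln (of_nat N))))"
      by (simp add: rGamma_series_def)
    also have "exp ((1 - b) * of_real (ln (of_nat N))) / exp (b * of_real (ln (of_nat N)))
        = exp ((1 - 2 * b) * of_real (ln (real N)))"
      by (simp add: algebra_simps flip: exp_diff)
    finally have "norm (blaschke (Suc N) b) = norm (rGamma_series (1 - b) N / rGamma_series b N)
        * norm (exp ((1 - 2 * b) * of_real (ln (real N))))"
      by (simp only: norm_mult)
    also have "norm (exp ((1 - 2 * b) * of_real (ln (real N)))) = real N powr (1 - 2 * Re b)"
      using that by (simp add: powr_def mult.commute)
    finally show ?thesis using K[of N] by (simp add: mult_right_mono)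
  qed
  then show ?thesis
    by (intro bigoI[of _ K]) (auto intro!: eventually_sequentiallyI[of 1])
qed

text \<open>A bound uniform in the imaginary part of b: as \<eta> \<le> 1/2, each factor has its largest modulus on the
  half-plane Re b \<ge> \<eta> at the point b = \<eta>.\<close>

lemma norm_blaschke_le:
  assumes "0 < \<eta>" "\<eta> \<le> 1/2" "\<eta> \<le> Re b"
  shows "norm (blaschke N b) \<le> norm (blaschke N (of_real \<eta>))"
  unfolding blaschke_def prod_norm[symmetric]
proof (intro prod_mono conjI norm_ge_zero)
  fix q :: nat
  define x y where "x = Re b" and "y = Im b"
  have x: "\<eta> \<le> x" using assms by (simp add: x_def)
  have 1: "(real q + 1 - x)\<^sup>2 * (real q + \<eta>)\<^sup>2 \<le> (real q + 1 - \<eta>)\<^sup>2 * (real q + x)\<^sup>2"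
  proof -
    have "\<bar>real q + 1 - x\<bar> * (real q + \<eta>) \<le> (real q + 1 - \<eta>) * (real q + x)"
    proof (cases "x \<le> real q + 1")
      case True
      then show ?thesis using assms x by (intro mult_mono) auto
    next
      case False
      then have "\<bar>real q + 1 - x\<bar> * (real q + \<eta>) \<le> (real q + x) * (real q + 1 - \<eta>)"
        using assms x by (intro mult_mono) auto
      then show ?thesis by (simp add: mult.commute)
    qed
    then have "(\<bar>real q + 1 - x\<bar> * (real q + \<eta>))\<^sup>2 \<le> ((real q + 1 - \<eta>) * (real q + x))\<^sup>2"
      using assms by (intro power_mono) auto
    then show ?thesis by (simp add: power_mult_distrib)
  qed
  have 2: "y\<^sup>2 * (real q + \<eta>)\<^sup>2 \<le> y\<^sup>2 * (real q + 1 - \<eta>)\<^sup>2"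
    using assms by (intro mult_left_mono power_mono) auto
  have "(norm (of_nat q + 1 - b) * (real q + \<eta>))\<^sup>2 \<le> ((real q + 1 - \<eta>) * norm (of_nat q + b))\<^sup>2"
    unfolding power_mult_distrib cmod_power2 using 1 2 by (simp add: x_def y_def algebra_simps)
  then have le: "norm (of_nat q + 1 - b) * (real q + \<eta>) \<le> (real q + 1 - \<eta>) * norm (of_nat q + b)"
    by (rule power2_le_imp_le) (use assms in auto)
  have "norm (of_nat q + 1 - complex_of_real \<eta>) = norm (of_real (real q + 1 - \<eta>) :: complex)" by simp
  then have 3: "norm (of_nat q + 1 - complex_of_real \<eta>) = real q + 1 - \<eta>" using assms by (simp only: norm_of_real)
  have "norm (of_nat q + complex_of_real \<eta>) = norm (of_real (real q + \<eta>) :: complex)" by simp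
  then have 4: "norm (of_nat q + complex_of_real \<eta>) = real q + \<eta>" using assms by (simp only: norm_of_real)
  have "of_nat q + b \<noteq> 0" using assms by (auto simp: complex_eq_iff)
  then show "norm ((of_nat q + 1 - b) / (of_nat q + b)) \<le> norm ((of_nat q + 1 - complex_of_real \<eta>) / (of_nat q + complex_of_real \<eta>))"
    unfolding norm_divide 3 4 using le assms by (simp add: divide_simps add_pos_pos add_nonneg_pos)
qed

section \<open>The remainder of the sampling series as a functional\<close>

definition sampling_error :: "real \<Rightarrow> complex \<Rightarrow> nat \<Rightarrow> (complex \<Rightarrow> complex) \<Rightarrow> complex"
  where "sampling_error \<epsilon> z N F = F z - (\<Sum>n=0..N. c_coeff n (z + \<i> / 2 - \<i> * of_real \<epsilon>) *
    (\<Sum>q=0..n. of_real (a_coeff n q) * F (\<i> * of_nat q + \<i> * of_real \<epsilon>)))"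

lemma sampling_error_add:
  "sampling_error \<epsilon> z N (\<lambda>\<zeta>. F \<zeta> + G \<zeta>) = sampling_error \<epsilon> z N F + sampling_error \<epsilon> z N G"
  by (simp add: sampling_error_def algebra_simps sum.distrib)

lemma sampling_error_cmult:
  "sampling_error \<epsilon> z N (\<lambda>\<zeta>. a * F \<zeta>) = a * sampling_error \<epsilon> z N F"
proof -
  have "(\<Sum>q=0..n. of_real (a_coeff n q) * (a * F (\<i> * of_nat q + \<i> * of_real \<epsilon>)))
      = a * (\<Sum>q=0..n. of_real (a_coeff n q) * F (\<i> * of_nat q + \<i> * of_real \<epsilon>))" for n
    by (simp add: sum_distrib_left mult_ac)
  then show ?thesis
    by (simp add: sampling_error_def right_diff_distrib sum_distrib_left mult_ac)
qed

lemma sampling_error_cong: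
  assumes "Im z \<ge> \<epsilon>" "\<And>\<zeta>. Im \<zeta> \<ge> \<epsilon> \<Longrightarrow> F \<zeta> = G \<zeta>"
  shows "sampling_error \<epsilon> z N F = sampling_error \<epsilon> z N G"
  using assms by (simp add: sampling_error_def)

lemma sampling_error_has_integral:
  assumes "Im z \<ge> \<epsilon>" "\<And>\<zeta>. Im \<zeta> \<ge> \<epsilon> \<Longrightarrow> ((\<lambda>x. k x \<zeta>) has_integral F \<zeta>) A"
  shows "((\<lambda>x. sampling_error \<epsilon> z N (k x)) has_integral sampling_error \<epsilon> z N F) A"
  unfolding sampling_error_def using assms
  by (intro has_integral_diff has_integral_sum has_integral_mult_right) auto

lemma sampling_error_tendsto:
  assumes "Im z \<ge> \<epsilon>" "\<And>\<zeta>. Im \<zeta> \<ge> \<epsilon> \<Longrightarrow> ((\<lambda>x. k x \<zeta>) \<longlongrightarrow> F \<zeta>) A"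
  shows "((\<lambda>x. sampling_error \<epsilon> z N (k x)) \<longlongrightarrow> sampling_error \<epsilon> z N F) A"
  unfolding sampling_error_def using assms
  by (intro tendsto_intros) auto

lemma sampling_error_has_field_derivative:
  assumes "Im z \<ge> \<epsilon>" "\<And>\<zeta>. Im \<zeta> \<ge> \<epsilon> \<Longrightarrow> ((\<lambda>p. k p \<zeta>) has_field_derivative F \<zeta>) (at p)"
  shows "((\<lambda>p. sampling_error \<epsilon> z N (k p)) has_field_derivative sampling_error \<epsilon> z N F) (at p)"
  unfolding sampling_error_def using assms
  by (intro DERIV_diff DERIV_sum DERIV_cmult) auto

lemma c_coeff_eq_blaschke:
  "c_coeff n (z + \<i> / 2 - \<i> * of_real \<epsilon>)
     = (2 * of_nat n + 1) * (blaschke n (1 - \<i> * z - of_real \<epsilon>) / (of_nat n + (1 - \<i> * z - of_real \<epsilon>)))"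
proof -
  define s where "s = 1 - \<i> * z - of_real \<epsilon>"
  have "(\<Prod>q=1..n. of_nat q - 1/2 + \<i> * (z + \<i> / 2 - \<i> * of_real \<epsilon>)) = (\<Prod>q<n. of_nat q + 1 - s)"
    by (rule prod.reindex_bij_witness[of _ Suc "\<lambda>q. q - 1"]) (auto simp: s_def algebra_simps of_nat_diff)
  moreover have "(\<Prod>q=0..n. of_nat q + 1/2 - \<i> * (z + \<i> / 2 - \<i> * of_real \<epsilon>)) = (\<Prod>q=0..n. of_nat q + s)"
    by (intro prod.cong refl) (auto simp: s_def algebra_simps)
  moreover have "(\<Prod>q=0..n. of_nat q + s) = (\<Prod>q<n. of_nat q + s) * (of_nat n + s)"
    by (simp add: atLeast0AtMost lessThan_Suc_atMost[symmetric])
  ultimately show ?thesis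
    unfolding c_coeff_def s_def[symmetric] by (simp add: blaschke_def prod_dividef)
qed

text \<open>Writing b = \<epsilon> + i p, the inner sums are - i times the partial fraction expansions at b, and
  s + b - 1 = - i (z - p) turns the telescoping identity into the closed form of the remainder.\<close>

lemma sampling_error_cauchy_kernel:
  assumes eps: "\<epsilon> > 0" and z: "Im z \<ge> \<epsilon>" and p: "Im p < \<epsilon>"
  shows "sampling_error \<epsilon> z N (\<lambda>\<zeta>. 1 / (\<zeta> - p))
    = blaschke (Suc N) (1 - \<i> * z - of_real \<epsilon>) * blaschke (Suc N) (of_real \<epsilon> + \<i> * p) / (z - p)"
proof -
  define s b where "s = 1 - \<i> * z - of_real \<epsilon>" and "b = of_real \<epsilon> + \<i> * p"
  have nzs: "of_nat q + s \<noteq> 0" and nzb: "of_nat q + b \<noteq> 0" for q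
    using assms by (auto simp: s_def b_def complex_eq_iff)
  have zp: "z - p \<noteq> 0" using z p by auto
  have sb: "s + b - 1 = - \<i> * (z - p)" by (simp add: s_def b_def algebra_simps)
  have inner: "(\<Sum>q=0..n. of_real (a_coeff n q) * (1 / (\<i> * of_nat q + \<i> * of_real \<epsilon> - p)))
      = - \<i> * (blaschke n b / (of_nat n + b))" for n
  proof -
    have "1 / (\<i> * of_nat q + \<i> * of_real \<epsilon> - p) = - \<i> * (1 / (of_nat q + b))" for q
    proof -
      have "\<i> * of_nat q + \<i> * of_real \<epsilon> - p = \<i> * (of_nat q + b)" by (simp add: b_def algebra_simps)
      then show ?thesis using nzb[of q] by (simp add: divide_simps)
    qed
    then have "(\<Sum>q=0..n. of_real (a_coeff n q) * (1 / (\<i> * of_nat q + \<i> * of_real \<epsilon> - p)))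
        = - \<i> * (\<Sum>q=0..n. of_real (a_coeff n q) / (of_nat q + b))"
      by (simp add: sum_distrib_left sum_negf mult.commute)
    then show ?thesis using a_coeff_partial_fractions[of n b] nzb by simp
  qed
  define T where "T = (\<Sum>n<Suc N. (2 * of_nat n + 1) * (blaschke n s / (of_nat n + s)) * (blaschke n b / (of_nat n + b)))"
  have tel: "(s + b - 1) * T = 1 - blaschke (Suc N) s * blaschke (Suc N) b"
    unfolding T_def by (rule blaschke_telescope) (use nzs nzb in auto)
  have "sampling_error \<epsilon> z N (\<lambda>\<zeta>. 1 / (\<zeta> - p)) = 1 / (z - p) + \<i> * T"
    unfolding sampling_error_def inner
    unfolding c_coeff_eq_blaschke s_def[symmetric] T_def lessThan_Suc_atMost atLeast0AtMost
    by (simp add: sum_distrib_left sum_negf mult_ac)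
  also have "\<dots> = (1 - (s + b - 1) * T) / (z - p)"
    unfolding sb using zp by (simp add: divide_simps)
  finally show ?thesis unfolding tel unfolding s_def b_def by simp
qed

lemma sampling_error_cauchy_kernel_holomorphic:
  assumes "Im z \<ge> \<epsilon>"
  shows "(\<lambda>p. sampling_error \<epsilon> z N (\<lambda>\<zeta>. 1 / (\<zeta> - p))) holomorphic_on {p. Im p < \<epsilon>}"
  unfolding sampling_error_def using assms
  by (intro holomorphic_intros) (auto simp: complex_eq_iff)

text \<open>The kernel 1 / \<zeta>^2 is the derivative of 1 / (\<zeta> - p) with respect to the pole p at p = 0.\<close>

lemma sampling_error_square_kernel:
  assumes eps: "\<epsilon> > 0" and z: "Im z \<ge> \<epsilon>"
  shows "sampling_error \<epsilon> z N (\<lambda>\<zeta>. 1 / \<zeta>\<^sup>2) = deriv (\<lambda>p. sampling_error \<epsilon> z N (\<lambda>\<zeta>. 1 / (\<zeta> - p))) 0"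
proof (rule DERIV_imp_deriv[symmetric], rule sampling_error_has_field_derivative[OF z])
  fix \<zeta> :: complex assume "\<epsilon> \<le> Im \<zeta>"
  then have "\<zeta> \<noteq> 0" using eps by auto
  then show "((\<lambda>p. 1 / (\<zeta> - p)) has_field_derivative 1 / \<zeta>\<^sup>2) (at 0)"
    by (auto intro!: derivative_eq_intros simp: power2_eq_square)
qed

text \<open>The kernel of the Nevanlinna representation divided by \<zeta>^2 is expanded in partial fractions. The pole
  coefficients blow up as t tends to 0, but they combine to the second divided difference of l
  at 0, 0, t and a difference of values of l, both of which stay bounded.\<close>

lemma sampling_error_pick_kernel:
  fixes t :: real and N :: nat
  assumes eps: "\<epsilon> > 0" and z: "Im z \<ge> \<epsilon>" and t: "t \<noteq> 0"
  defines "l \<equiv> \<lambda>p. sampling_error \<epsilon> z N (\<lambda>\<zeta>. 1 / (\<zeta> - p))"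
  shows "sampling_error \<epsilon> z N (\<lambda>\<zeta>. (1 + of_real t * \<zeta>) / (of_real t - \<zeta>) / \<zeta>\<^sup>2)
    = - (1 / of_real t ^ 2) * (l t - (l 0 + deriv l 0 * t)) - l t + l 0"
proof -
  have "sampling_error \<epsilon> z N (\<lambda>\<zeta>. (1 + of_real t * \<zeta>) / (of_real t - \<zeta>) / \<zeta>\<^sup>2)
     = sampling_error \<epsilon> z N (\<lambda>\<zeta>. (- (1 / of_real t ^ 2) - 1) * (1 / (\<zeta> - of_real t))
         + ((1 / of_real t ^ 2 + 1) * (1 / (\<zeta> - 0)) + (1 / of_real t) * (1 / \<zeta>\<^sup>2)))"
  proof (rule sampling_error_cong[OF z])
    fix \<zeta> :: complex assume "\<epsilon> \<le> Im \<zeta>"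
    then have nz: "\<zeta> \<noteq> 0" "\<zeta> \<noteq> of_real t" using eps by auto
    have rational: "(1 + u * \<zeta>) / (u - \<zeta>) / \<zeta>\<^sup>2 = (- (1 / u ^ 2) - 1) * (1 / (\<zeta> - u))
         + ((1 / u ^ 2 + 1) * (1 / \<zeta>) + (1 / u) * (1 / \<zeta>\<^sup>2))"
      if "u \<noteq> 0" "\<zeta> \<noteq> u" for u :: complex
      using that nz by (simp add: divide_simps power2_eq_square) algebra
    show "(1 + of_real t * \<zeta>) / (of_real t - \<zeta>) / \<zeta>\<^sup>2
      = (- (1 / of_real t ^ 2) - 1) * (1 / (\<zeta> - of_real t))
         + ((1 / of_real t ^ 2 + 1) * (1 / (\<zeta> - 0)) + (1 / of_real t) * (1 / \<zeta>\<^sup>2))"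
      using rational[of "of_real t"] nz t by simp
  qed
  also have "\<dots> = (- (1 / of_real t ^ 2) - 1) * l t + ((1 / of_real t ^ 2 + 1) * l 0 + (1 / of_real t) * deriv l 0)"
    unfolding sampling_error_add sampling_error_cmult sampling_error_square_kernel[OF eps z] l_def ..
  also have "\<dots> = - (1 / of_real t ^ 2) * (l t - (l 0 + deriv l 0 * t)) - l t + l 0"
    using t by (simp add: field_simps power2_eq_square)
  finally show ?thesis .
qed

text \<open>A bound for l in a half-plane that contains a \<delta>-neighbourhood of the real axis bounds its first two
  derivatives on the real axis by Cauchy's estimates, and Taylor's formula then controls the divided
  difference uniformly in t.\<close>

lemma norm_sampling_error_kernels_le:
  fixes t :: real
  assumes z: "Im z \<ge> \<epsilon>" and \<delta>: "0 < \<delta>" "\<delta> < \<epsilon>"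
    and M: "\<And>p. Im p \<le> \<delta> \<Longrightarrow> norm (sampling_error \<epsilon> z N (\<lambda>\<zeta>. 1 / (\<zeta> - p))) \<le> M"
  shows "norm (sampling_error \<epsilon> z N (\<lambda>\<zeta>. 1 / \<zeta>\<^sup>2)) \<le> M / \<delta>"
    and "t \<noteq> 0 \<Longrightarrow> norm (sampling_error \<epsilon> z N (\<lambda>\<zeta>. (1 + of_real t * \<zeta>) / (of_real t - \<zeta>) / \<zeta>\<^sup>2))
      \<le> 2 * M / \<delta>\<^sup>2 + 2 * M"
proof -
  define l where "l = (\<lambda>p. sampling_error \<epsilon> z N (\<lambda>\<zeta>. 1 / (\<zeta> - p)))"
  have eps: "\<epsilon> > 0" using \<delta> by simp
  define H where "H = {p. Im p < \<epsilon>}"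
  have openH: "open H" unfolding H_def by (rule open_halfspace_Im_lt)
  have hol: "l holomorphic_on H"
    unfolding l_def H_def by (rule sampling_error_cauchy_kernel_holomorphic[OF z])
  have cauchy: "norm ((deriv ^^ n) l p) \<le> fact n * M / \<delta> ^ n" if "Im p = 0" for n p
  proof (rule Cauchy_inequality)
    have sub: "cball p \<delta> \<subseteq> H"
    proof
      fix x assume "x \<in> cball p \<delta>"
      then have "norm (x - p) \<le> \<delta>" by (simp add: dist_norm norm_minus_commute)
      then have "Im (x - p) \<le> \<delta>" using abs_Im_le_cmod[of "x - p"] by linarith
      then show "x \<in> H" using that \<delta> by (simp add: H_def)
    qed
    then show "l holomorphic_on ball p \<delta>" using hol holomorphic_on_subset by (meson ball_subset_cball subset_trans)
    show "continuous_on (cball p \<delta>) l"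
      using hol sub holomorphic_on_imp_continuous_on holomorphic_on_subset by blast
    show "norm (l x) \<le> M" if "norm (p - x) = \<delta>" for x
    proof -
      have "Im (x - p) \<le> \<delta>" using abs_Im_le_cmod[of "x - p"] that by (simp add: norm_minus_commute)
      then show ?thesis unfolding l_def using \<open>Im p = 0\<close> by (intro M) simp
    qed
  qed (use \<delta> in auto)
  have "norm (deriv l 0) \<le> M / \<delta>" using cauchy[of 0 1] by simp
  then show "norm (sampling_error \<epsilon> z N (\<lambda>\<zeta>. 1 / \<zeta>\<^sup>2)) \<le> M / \<delta>"
    unfolding sampling_error_square_kernel[OF eps z] l_def .
  assume t: "t \<noteq> 0"
  have "norm ((deriv ^^ 0) l (of_real t) - (\<Sum>i\<le>1. (deriv ^^ i) l 0 * (of_real t - 0) ^ i / fact i))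
      \<le> (2 * M / \<delta>\<^sup>2) * norm (of_real t - 0 :: complex) ^ Suc 1 / fact 1"
  proof (rule complex_Taylor[of "{p. Im p = 0}"])
    show "convex {p. Im p = 0}" by (simp add: convex_def)
    show "norm ((deriv ^^ Suc 1) l x) \<le> 2 * M / \<delta>\<^sup>2" if "x \<in> {p. Im p = 0}" for x
      using cauchy[of x 2] that by (simp add: numeral_2_eq_2)
    show "((deriv ^^ i) l has_field_derivative (deriv ^^ Suc i) l x) (at x within {p. Im p = 0})"
      if "x \<in> {p. Im p = 0}" for i x
    proof -
      have "x \<in> H" using that eps by (simp add: H_def)
      then show ?thesis
        using holomorphic_derivI[OF holomorphic_higher_deriv[OF hol openH, of i] openH]
        by (auto intro: has_field_derivative_at_within)
    qed
  qed auto
  then have "norm (l t - (l 0 + deriv l 0 * t)) \<le> 2 * M / \<delta>\<^sup>2 * t\<^sup>2"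
    by (simp add: power2_eq_square)
  then have 1: "norm (- (1 / complex_of_real t ^ 2) * (l t - (l 0 + deriv l 0 * t))) \<le> 2 * M / \<delta>\<^sup>2"
    using t \<delta> by (simp add: norm_mult norm_divide norm_power divide_simps)
  have 2: "norm (l t) \<le> M" "norm (l 0) \<le> M" using M[of "of_real t"] M[of 0] \<delta> by (auto simp: l_def)
  have "sampling_error \<epsilon> z N (\<lambda>\<zeta>. (1 + of_real t * \<zeta>) / (of_real t - \<zeta>) / \<zeta>\<^sup>2)
    = - (1 / of_real t ^ 2) * (l t - (l 0 + deriv l 0 * t)) - l t + l 0"
    unfolding l_def by (rule sampling_error_pick_kernel[OF eps z t])
  also have "norm \<dots> \<le> 2 * M / \<delta>\<^sup>2 + M + M"
    using 1 2 by (intro norm_triangle_le norm_triangle_le_diff add_mono) auto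
  finally show "norm (sampling_error \<epsilon> z N (\<lambda>\<zeta>. (1 + of_real t * \<zeta>) / (of_real t - \<zeta>) / \<zeta>\<^sup>2))
      \<le> 2 * M / \<delta>\<^sup>2 + 2 * M" by simp
qed

text \<open>For poles p with Im p \<le> \<delta> = \<epsilon> - \<eta> one has Re (\<epsilon> + i p) \<ge> \<eta>, so the remainder for the Cauchy kernel is of
  order N^(1 - 2 Re s) N^(1 - 2 \<eta>) with Re s = 1 + Im z - \<epsilon>. The exponent - 2 (Im z - \<epsilon>) - 2 \<eta> lies
  below 1/2 + \<epsilon> - Im z.\<close>

lemma sampling_error_kernels_decay:
  assumes eps: "\<epsilon> > 0" and z: "Im z > 1/2 + \<epsilon>"
  obtains C N0 where "C \<ge> 0"
    and "\<And>N. N \<ge> N0 \<Longrightarrow> norm (sampling_error \<epsilon> z N (\<lambda>\<zeta>. 1 / \<zeta>\<^sup>2)) \<le> C * real N powr (1/2 + \<epsilon> - Im z)"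
    and "\<And>N t. N \<ge> N0 \<Longrightarrow> t \<noteq> 0 \<Longrightarrow>
      norm (sampling_error \<epsilon> z N (\<lambda>\<zeta>. (1 + complex_of_real t * \<zeta>) / (of_real t - \<zeta>) / \<zeta>\<^sup>2))
        \<le> C * real N powr (1/2 + \<epsilon> - Im z)"
proof -
  \<comment> \<open>\<eta> \<le> 1/2 is what the uniform bound for the products asks for, \<eta> < \<epsilon> leaves room for \<delta> > 0.\<close>
  define \<eta> where "\<eta> = min (\<epsilon> / 2) (1 / 2)"
  define \<delta> where "\<delta> = \<epsilon> - \<eta>"
  have \<eta>: "0 < \<eta>" "\<eta> \<le> 1/2" "\<eta> < \<epsilon>" using eps by (auto simp: \<eta>_def)
  then have \<delta>: "0 < \<delta>" "\<delta> < \<epsilon>" using eps by (auto simp: \<delta>_def)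
  define s where "s = 1 - \<i> * z - of_real \<epsilon>"
  have Res: "Re s = 1 + Im z - \<epsilon>" by (simp add: s_def)
  have "(\<lambda>N. norm (blaschke (Suc N) s)) \<in> O(\<lambda>N. real N powr (1 - 2 * Re s))"
    by (rule blaschke_bigo) (use z Res in auto)
  moreover have "(\<lambda>N. norm (blaschke (Suc N) (of_real \<eta>))) \<in> O(\<lambda>N. real N powr (1 - 2 * \<eta>))"
    using blaschke_bigo[of "of_real \<eta>"] \<eta> by simp
  ultimately obtain K1 K2 where K: "K1 > 0" "K2 > 0"
     "eventually (\<lambda>N. norm (blaschke (Suc N) s) \<le> K1 * real N powr (1 - 2 * Re s)) sequentially"
     "eventually (\<lambda>N. norm (blaschke (Suc N) (of_real \<eta>)) \<le> K2 * real N powr (1 - 2 * \<eta>)) sequentially"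
    by (fastforce elim!: landau_o.bigE)
  from eventually_conj[OF K(3,4)] obtain N1 where
    N1: "\<And>N. N \<ge> N1 \<Longrightarrow> norm (blaschke (Suc N) s) \<le> K1 * real N powr (1 - 2 * Re s)"
        "\<And>N. N \<ge> N1 \<Longrightarrow> norm (blaschke (Suc N) (of_real \<eta>)) \<le> K2 * real N powr (1 - 2 * \<eta>)"
    by (auto simp: eventually_sequentially)
  define D where "D = 2 * K1 * K2"
  have D: "D > 0" using K by (simp add: D_def)
  have main: "norm (sampling_error \<epsilon> z N (\<lambda>\<zeta>. 1 / (\<zeta> - p))) \<le> D * real N powr (1/2 + \<epsilon> - Im z)"
    if N: "N \<ge> max N1 1" and p: "Im p \<le> \<delta>" for N p
  proof -
    have zp: "norm (z - p) \<ge> 1/2"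
      using abs_Im_le_cmod[of "z - p"] p z \<delta> by simp
    have b: "norm (blaschke (Suc N) (of_real \<epsilon> + \<i> * p)) \<le> norm (blaschke (Suc N) (of_real \<eta>))"
      using p \<eta> by (intro norm_blaschke_le) (auto simp: \<delta>_def)
    have "norm (sampling_error \<epsilon> z N (\<lambda>\<zeta>. 1 / (\<zeta> - p)))
      = norm (blaschke (Suc N) s) * norm (blaschke (Suc N) (of_real \<epsilon> + \<i> * p)) / norm (z - p)"
      unfolding s_def
      by (subst sampling_error_cauchy_kernel[OF eps]) (use z p \<delta> in \<open>auto simp: norm_mult norm_divide\<close>)
    also have "\<dots> \<le> (K1 * real N powr (1 - 2 * Re s)) * (K2 * real N powr (1 - 2 * \<eta>)) / (1/2)"
      using zp b N1[of N] N K by (intro frac_le mult_mono) auto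
    also have "\<dots> = D * (real N powr (1 - 2 * Re s) * real N powr (1 - 2 * \<eta>))"
      by (simp add: D_def)
    also have "\<dots> = D * real N powr (1 - 2 * Re s + (1 - 2 * \<eta>))"
      by (simp only: powr_add)
    also have "\<dots> \<le> D * real N powr (1/2 + \<epsilon> - Im z)"
      using D N z \<eta> by (intro mult_left_mono powr_mono) (auto simp: Res)
    finally show ?thesis .
  qed
  define C where "C = 2 * D / \<delta>\<^sup>2 + 2 * D + D / \<delta>"
  have "C \<ge> 0" using D \<delta> by (simp add: C_def)
  moreover have "norm (sampling_error \<epsilon> z N (\<lambda>\<zeta>. 1 / \<zeta>\<^sup>2)) \<le> C * real N powr (1/2 + \<epsilon> - Im z)"
    if N: "N \<ge> max N1 1" for N
  proof -
    have "norm (sampling_error \<epsilon> z N (\<lambda>\<zeta>. 1 / \<zeta>\<^sup>2)) \<le> D * real N powr (1/2 + \<epsilon> - Im z) / \<delta>"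
      by (rule norm_sampling_error_kernels_le(1)) (use main[OF N] \<delta> z in auto)
    also have "\<dots> = (D / \<delta>) * real N powr (1/2 + \<epsilon> - Im z)" by simp
    also have "\<dots> \<le> C * real N powr (1/2 + \<epsilon> - Im z)"
      using D \<delta> by (intro mult_right_mono) (auto simp: C_def)
    finally show ?thesis .
  qed
  moreover have "norm (sampling_error \<epsilon> z N (\<lambda>\<zeta>. (1 + complex_of_real t * \<zeta>) / (of_real t - \<zeta>) / \<zeta>\<^sup>2))
        \<le> C * real N powr (1/2 + \<epsilon> - Im z)"
    if N: "N \<ge> max N1 1" and t: "t \<noteq> 0" for N t
  proof -
    have "norm (sampling_error \<epsilon> z N (\<lambda>\<zeta>. (1 + complex_of_real t * \<zeta>) / (of_real t - \<zeta>) / \<zeta>\<^sup>2))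
       \<le> 2 * (D * real N powr (1/2 + \<epsilon> - Im z)) / \<delta>\<^sup>2 + 2 * (D * real N powr (1/2 + \<epsilon> - Im z))"
      by (rule norm_sampling_error_kernels_le(2)) (use main[OF N] \<delta> z t in auto)
    also have "\<dots> = (2 * D / \<delta>\<^sup>2 + 2 * D) * real N powr (1/2 + \<epsilon> - Im z)" by (simp add: algebra_simps)
    also have "\<dots> \<le> C * real N powr (1/2 + \<epsilon> - Im z)"
      using D \<delta> by (intro mult_right_mono) (auto simp: C_def)
    finally show ?thesis .
  qed
  ultimately show thesis by (rule that)
qed

section \<open>The remainder for Nevanlinna functions\<close>

lemma Cauchy_integral_unit_circle:
  assumes "h holomorphic_on cball 0 1" "norm w < 1"
  shows "((\<lambda>x. h (cis (2 * pi * x)) * (cis (2 * pi * x) / (cis (2 * pi * x) - w))) has_integral h w) {0..1}"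
proof -
  have "((\<lambda>u. h u / (u - w)) has_contour_integral 2 * of_real pi * \<i> * h w) (circlepath 0 1)"
    using assms by (intro Cauchy_integral_circlepath_simple) auto
  then have "((\<lambda>x. h (cis (2 * pi * x)) / (cis (2 * pi * x) - w) * (2 * of_real pi * \<i> * cis (2 * pi * x)))
      has_integral 2 * of_real pi * \<i> * h w) {0..1}"
    unfolding has_contour_integral_def
  proof (rule has_integral_eq[rotated])
    fix x :: real assume x: "x \<in> {0..1}"
    have e: "exp (2 * of_real pi * \<i> * of_real x) = cis (2 * pi * x)"
      by (simp add: cis_conv_exp mult_ac)
    have d: "vector_derivative (circlepath 0 1) (at x within {0..1}) = 2 * of_real pi * \<i> * cis (2 * pi * x)"
      using vector_derivative_circlepath01[of x 0 1] x e by simp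
    have c: "circlepath 0 1 x = cis (2 * pi * x)"
      unfolding circlepath using e by simp
    show "h (circlepath 0 1 x) / (circlepath 0 1 x - w) * vector_derivative (circlepath 0 1) (at x within {0..1})
      = h (cis (2 * pi * x)) / (cis (2 * pi * x) - w) * (2 * of_real pi * \<i> * cis (2 * pi * x))"
      unfolding c d ..
  qed
  from has_integral_mult_right[OF this, of "1 / (2 * of_real pi * \<i>)"] show ?thesis
    by (simp add: mult_ac)
qed

text \<open>The Cauchy formula for g is added to the conjugate of the mean value property of the holomorphic function
  g(v) / (1 - cnj w * v); on the unit circle 1 / (1 - w * cnj e) = e / (e - w), so both integrals have the same kernel.\<close>

lemma Schwarz_integral_unit_circle:
  assumes hol: "g holomorphic_on cball 0 1" and w: "norm w < 1"
  shows "((\<lambda>x. of_real (Re (g (cis (2 * pi * x)))) * (2 * cis (2 * pi * x) / (cis (2 * pi * x) - w)))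
    has_integral g w + cnj (g 0)) {0..1}"
proof -
  have nz: "1 - cnj w * v \<noteq> 0" if "v \<in> cball 0 1" for v
  proof
    assume "1 - cnj w * v = 0"
    then have "norm (cnj w * v) = 1" by (metis eq_iff_diff_eq_0 norm_one)
    moreover have "norm (cnj w * v) \<le> norm w * 1"
      unfolding norm_mult using that by (intro mult_mono) auto
    ultimately show False using w by simp
  qed
  have "(\<lambda>v. g v / (1 - cnj w * v)) holomorphic_on cball 0 1"
    using hol nz by (intro holomorphic_intros) auto
  from Cauchy_integral_unit_circle[OF this, of 0]
  have "((\<lambda>x. g (cis (2 * pi * x)) / (1 - cnj w * cis (2 * pi * x))) has_integral g 0) {0..1}"
    by simp
  then have "((\<lambda>x. cnj (g (cis (2 * pi * x)) / (1 - cnj w * cis (2 * pi * x)))) has_integral cnj (g 0)) {0..1}"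
    by (rule has_integral_cnj[THEN iffD2, unfolded o_def])
  moreover have "cnj (g (cis (2 * pi * x)) / (1 - cnj w * cis (2 * pi * x)))
      = cnj (g (cis (2 * pi * x))) * (cis (2 * pi * x) / (cis (2 * pi * x) - w))" for x
  proof -
    define c where "c = cis (2 * pi * x)"
    have "c \<noteq> 0" "c * cnj c = 1" by (simp_all add: c_def cis_cnj cis_mult)
    then have "c - w = c * (1 - w * cnj c)" by (simp add: right_diff_distrib mult.left_commute)
    then have "c / (c - w) = 1 / (1 - w * cnj c)" using \<open>c \<noteq> 0\<close> by simp
    then show ?thesis unfolding c_def[symmetric] by simp
  qed
  ultimately have "((\<lambda>x. cnj (g (cis (2 * pi * x))) * (cis (2 * pi * x) / (cis (2 * pi * x) - w)))
      has_integral cnj (g 0)) {0..1}"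
    by simp
  from has_integral_add[OF Cauchy_integral_unit_circle[OF hol w] this]
  have "((\<lambda>x. (g (cis (2 * pi * x)) + cnj (g (cis (2 * pi * x)))) * (cis (2 * pi * x) / (cis (2 * pi * x) - w)))
      has_integral g w + cnj (g 0)) {0..1}"
    by (simp only: distrib_right)
  then show ?thesis
    unfolding complex_add_cnj by (simp add: mult_ac)
qed

lemma cayley_upper_half_plane:
  assumes "norm v < 1"
  shows "Im (\<i> * (1 + v) / (1 - v)) > 0"
proof -
  have "v \<noteq> 1" using assms by auto
  then have nz: "norm (1 - v) > 0" by simp
  have "Im (\<i> * (1 + v) / (1 - v)) = (1 - (norm v)\<^sup>2) / (norm (1 - v))\<^sup>2"
    unfolding cmod_power2 by (simp add: Im_divide power2_eq_square algebra_simps)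
  moreover have "(norm v)\<^sup>2 < 1" using assms by (simp add: power_less_one_iff)
  ultimately show ?thesis using nz by simp
qed

lemma cayley_inverse:
  assumes "Im \<zeta> > 0"
  shows "norm ((\<zeta> - \<i>) / (\<zeta> + \<i>)) < 1"
    and "\<i> * (1 + (\<zeta> - \<i>) / (\<zeta> + \<i>)) / (1 - (\<zeta> - \<i>) / (\<zeta> + \<i>)) = \<zeta>"
proof -
  have nz: "\<zeta> + \<i> \<noteq> 0" using assms by (auto simp: complex_eq_iff)
  have "(norm (\<zeta> - \<i>))\<^sup>2 < (norm (\<zeta> + \<i>))\<^sup>2"
    unfolding cmod_power2 using assms by (simp add: power2_eq_square algebra_simps)
  then have "norm (\<zeta> - \<i>) < norm (\<zeta> + \<i>)" by (rule power2_less_imp_less) simp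
  then show "norm ((\<zeta> - \<i>) / (\<zeta> + \<i>)) < 1" using nz by (simp add: norm_divide)
  have "1 + (\<zeta> - \<i>) / (\<zeta> + \<i>) = 2 * \<zeta> / (\<zeta> + \<i>)"
       "1 - (\<zeta> - \<i>) / (\<zeta> + \<i>) = 2 * \<i> / (\<zeta> + \<i>)"
    using nz by (auto simp: divide_simps)
  then show "\<i> * (1 + (\<zeta> - \<i>) / (\<zeta> + \<i>)) / (1 - (\<zeta> - \<i>) / (\<zeta> + \<i>)) = \<zeta>"
    using nz by simp
qed

text \<open>Under the Cayley transform the point e of the circle corresponds to the point t of the real line.
  The excluded points 1 and -1 correspond to infinity and to 0.\<close>

lemma schwarz_kernel_eq_pick_kernel:
  fixes e :: complex
  assumes e: "norm e = 1" "e \<noteq> 1" "e \<noteq> -1"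
  obtains t :: real where "t \<noteq> 0"
    "\<And>\<zeta>. Im \<zeta> > 0 \<Longrightarrow>
       2 * e / (e - (\<zeta> - \<i>) / (\<zeta> + \<i>)) = 1 - \<i> * ((1 + of_real t * \<zeta>) / (of_real t - \<zeta>))"
proof -
  define u where "u = \<i> * (1 + e) / (1 - e)"
  have e1: "1 - e \<noteq> 0" "1 + e \<noteq> 0" using e by (auto simp: add_eq_0_iff)
  have "Im u = (1 - (norm e)\<^sup>2) / (norm (1 - e))\<^sup>2"
    unfolding u_def cmod_power2 by (simp add: Im_divide power2_eq_square algebra_simps)
  then have "Im u = 0" using e by simp
  then have ut: "u = of_real (Re u)" by (simp add: complex_eq_iff)
  have "u \<noteq> 0" using e1 by (simp add: u_def)
  then have t: "Re u \<noteq> 0" using ut by (metis of_real_0)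
  have eu: "e * (u + \<i>) = u - \<i>" using e1 by (simp add: u_def divide_simps) (simp add: algebra_simps)
  have ui: "u + \<i> \<noteq> 0" using \<open>Im u = 0\<close> by (auto simp: complex_eq_iff)
  have "2 * e / (e - (\<zeta> - \<i>) / (\<zeta> + \<i>)) = 1 - \<i> * ((1 + u * \<zeta>) / (u - \<zeta>))" if \<zeta>: "Im \<zeta> > 0" for \<zeta>
  proof -
    have nz: "\<zeta> + \<i> \<noteq> 0" using \<zeta> by (auto simp: complex_eq_iff)
    have u\<zeta>: "u - \<zeta> \<noteq> 0" using \<zeta> \<open>Im u = 0\<close> by auto
    have e_eq: "e = (u - \<i>) / (u + \<i>)" using eu ui by (simp add: eq_divide_eq)
    have "(u - \<i>) * (\<zeta> + \<i>) - (\<zeta> - \<i>) * (u + \<i>) = 2 * \<i> * (u - \<zeta>)" by (simp add: algebra_simps)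
    then have den: "e - (\<zeta> - \<i>) / (\<zeta> + \<i>) = 2 * \<i> * (u - \<zeta>) / ((u + \<i>) * (\<zeta> + \<i>))"
      unfolding e_eq using nz ui by (simp add: diff_frac_eq)
    have "2 * e / (e - (\<zeta> - \<i>) / (\<zeta> + \<i>)) = - \<i> * (u - \<i>) * (\<zeta> + \<i>) / (u - \<zeta>)"
      unfolding den unfolding e_eq using nz ui u\<zeta>
      by (simp add: divide_simps) (simp add: algebra_simps)
    also have "- \<i> * (u - \<i>) * (\<zeta> + \<i>) = (u - \<zeta>) - \<i> * (1 + u * \<zeta>)"
      by (simp add: algebra_simps)
    also have "\<dots> / (u - \<zeta>) = 1 - \<i> * ((1 + u * \<zeta>) / (u - \<zeta>))"
      using u\<zeta> by (simp add: diff_divide_distrib)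
    finally show ?thesis .
  qed
  then show thesis using that[OF t] ut by simp
qed

text \<open>The Schwarz formula expresses g as an average of kernels with the density Re g \<ge> 0 on the circle. The
  remainder is linear, hence an average of the remainders of the kernels, and the mass Re (g 0) of the density
  multiplies their common bound.\<close>

lemma norm_sampling_error_positive_le:
  assumes eps: "\<epsilon> > 0" and z: "Im z \<ge> \<epsilon>"
    and B1: "norm (sampling_error \<epsilon> z N (\<lambda>\<zeta>. 1 / \<zeta>\<^sup>2)) \<le> B"
    and B2: "\<And>t. t \<noteq> 0 \<Longrightarrow>
      norm (sampling_error \<epsilon> z N (\<lambda>\<zeta>. (1 + complex_of_real t * \<zeta>) / (of_real t - \<zeta>) / \<zeta>\<^sup>2)) \<le> B"
    and hol: "g holomorphic_on cball 0 1" and pos: "\<And>v. norm v = 1 \<Longrightarrow> Re (g v) \<ge> 0"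
  shows "norm (sampling_error \<epsilon> z N (\<lambda>\<zeta>. g ((\<zeta> - \<i>) / (\<zeta> + \<i>)) / \<zeta>\<^sup>2)) \<le> 3 * norm (g 0) * B"
proof -
  define e where "e = (\<lambda>x. cis (2 * pi * x))"
  define w where "w = (\<lambda>\<zeta>::complex. (\<zeta> - \<i>) / (\<zeta> + \<i>))"
  define k where "k = (\<lambda>x \<zeta>. of_real (Re (g (e x))) * (2 * e x / (e x - w \<zeta>)) / \<zeta>\<^sup>2)"
  \<comment> \<open>The parameters of the points 1 and -1 of the circle, which form a null set.\<close>
  define S where "S = {0, 1/2, 1 :: real}"
  have B: "B \<ge> 0" using B1 norm_ge_zero order_trans by blast
  have int: "((\<lambda>x. sampling_error \<epsilon> z N (k x)) has_integral
      sampling_error \<epsilon> z N (\<lambda>\<zeta>. (g (w \<zeta>) + cnj (g 0)) / \<zeta>\<^sup>2)) {0..1}"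
  proof (rule sampling_error_has_integral[OF z])
    fix \<zeta> :: complex assume "\<epsilon> \<le> Im \<zeta>"
    then have "norm (w \<zeta>) < 1" using eps cayley_inverse(1)[of \<zeta>] by (simp add: w_def)
    from has_integral_divide[OF Schwarz_integral_unit_circle[OF hol this]]
    show "((\<lambda>x. k x \<zeta>) has_integral (g (w \<zeta>) + cnj (g 0)) / \<zeta>\<^sup>2) {0..1}"
      unfolding k_def e_def .
  qed
  have bound: "norm (sampling_error \<epsilon> z N (k x)) \<le> 2 * B * Re (g (e x))" if x: "x \<in> {0..1} - S" for x
  proof -
    have e: "norm (e x) = 1" by (simp add: e_def)
    have "e x \<noteq> 1"
    proof
      assume "e x = 1"
      then have "exp (2 * of_real pi * \<i> * of_real x) = 1" by (simp add: e_def cis_conv_exp mult_ac)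
      then obtain n :: int where "Im (2 * of_real pi * \<i> * of_real x) = of_int (2 * n) * pi"
        unfolding exp_eq_1 by blast
      then have "x = of_int n" by simp
      then have "x = 0 \<or> x = 1" using x by auto
      then show False using x by (auto simp: S_def)
    qed
    moreover have "e x \<noteq> -1"
    proof
      assume "e x = -1"
      then have "e x * e x = 1" by simp
      then have "cis (2 * pi * x + 2 * pi * x) = 1" unfolding e_def cis_mult .
      then have "exp (2 * of_real pi * \<i> * of_real (2 * x)) = 1"
        by (simp add: cis_conv_exp mult_ac)
      then obtain n :: int where "Im (2 * of_real pi * \<i> * of_real (2 * x)) = of_int (2 * n) * pi"
        unfolding exp_eq_1 by blast
      then have "2 * x = of_int n" by simp
      moreover have "0 \<le> x" "x \<le> 1" using x by auto
      ultimately have "0 \<le> n" "n \<le> 2" by linarith+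
      then have "n = 0 \<or> n = 1 \<or> n = 2" by auto
      then have "x = 0 \<or> x = 1/2 \<or> x = 1" using \<open>2 * x = of_int n\<close> by auto
      then show False using x unfolding S_def by blast
    qed
    ultimately obtain t :: real where t: "t \<noteq> 0" and
      kern: "\<And>\<zeta>. Im \<zeta> > 0 \<Longrightarrow> 2 * e x / (e x - w \<zeta>) = 1 - \<i> * ((1 + of_real t * \<zeta>) / (of_real t - \<zeta>))"
      unfolding w_def using schwarz_kernel_eq_pick_kernel[OF e] by blast
    have "sampling_error \<epsilon> z N (k x) = sampling_error \<epsilon> z N (\<lambda>\<zeta>. of_real (Re (g (e x))) *
        (1 / \<zeta>\<^sup>2 + (- \<i>) * ((1 + of_real t * \<zeta>) / (of_real t - \<zeta>) / \<zeta>\<^sup>2)))"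
    proof (rule sampling_error_cong[OF z])
      fix \<zeta> :: complex assume "\<epsilon> \<le> Im \<zeta>"
      then have "Im \<zeta> > 0" using eps by simp
      from kern[OF this] show "k x \<zeta> = of_real (Re (g (e x))) *
          (1 / \<zeta>\<^sup>2 + (- \<i>) * ((1 + of_real t * \<zeta>) / (of_real t - \<zeta>) / \<zeta>\<^sup>2))"
        unfolding k_def by (simp only: diff_divide_distrib times_divide_eq_right[symmetric]) simp
    qed
    also have "\<dots> = of_real (Re (g (e x))) * (sampling_error \<epsilon> z N (\<lambda>\<zeta>. 1 / \<zeta>\<^sup>2)
         + (- \<i>) * sampling_error \<epsilon> z N (\<lambda>\<zeta>. (1 + of_real t * \<zeta>) / (of_real t - \<zeta>) / \<zeta>\<^sup>2))"
      unfolding sampling_error_cmult sampling_error_add ..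
    also have "norm \<dots> \<le> Re (g (e x)) * (B + B)"
      unfolding norm_mult using pos[OF e] B1 B2[OF t]
      by (intro mult_mono norm_triangle_le add_mono) (auto simp: norm_mult)
    finally show ?thesis by (simp add: algebra_simps)
  qed
  have mean: "((\<lambda>x. 2 * B * Re (g (e x))) has_integral 2 * B * Re (g 0)) {0..1}"
  proof -
    have "((\<lambda>x. g (e x)) has_integral g 0) {0..1}"
      using Cauchy_integral_unit_circle[OF hol, of 0] by (simp add: e_def)
    then show ?thesis by (intro has_integral_mult_right has_integral_Re)
  qed
  have "((\<lambda>x. if x \<in> S then 0 else sampling_error \<epsilon> z N (k x)) has_integral
      sampling_error \<epsilon> z N (\<lambda>\<zeta>. (g (w \<zeta>) + cnj (g 0)) / \<zeta>\<^sup>2)) {0..1}"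
    by (rule has_integral_spike_finite[OF _ _ int, of S]) (auto simp: S_def)
  moreover have "norm (if x \<in> S then 0 else sampling_error \<epsilon> z N (k x)) \<le> 2 * B * Re (g (e x))"
    if "x \<in> {0..1}" for x
    using bound[of x] that pos[of "e x"] B by (auto simp: e_def)
  ultimately have "norm (sampling_error \<epsilon> z N (\<lambda>\<zeta>. (g (w \<zeta>) + cnj (g 0)) / \<zeta>\<^sup>2)) \<le> 2 * B * Re (g 0)"
    using mean by (metis (no_types, lifting) has_integral_integrable integral_norm_bound_integral integral_unique)
  moreover have "sampling_error \<epsilon> z N (\<lambda>\<zeta>. (g (w \<zeta>) + cnj (g 0)) / \<zeta>\<^sup>2)
      = sampling_error \<epsilon> z N (\<lambda>\<zeta>. g (w \<zeta>) / \<zeta>\<^sup>2) + cnj (g 0) * sampling_error \<epsilon> z N (\<lambda>\<zeta>. 1 / \<zeta>\<^sup>2)"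
    by (simp add: add_divide_distrib flip: sampling_error_add sampling_error_cmult)
  moreover have "norm (cnj (g 0) * sampling_error \<epsilon> z N (\<lambda>\<zeta>. 1 / \<zeta>\<^sup>2)) \<le> norm (g 0) * B"
    unfolding norm_mult using B1 by (intro mult_mono) auto
  ultimately have "norm (sampling_error \<epsilon> z N (\<lambda>\<zeta>. g (w \<zeta>) / \<zeta>\<^sup>2)) \<le> 2 * B * Re (g 0) + norm (g 0) * B"
    using norm_diff_ineq[of "sampling_error \<epsilon> z N (\<lambda>\<zeta>. g (w \<zeta>) / \<zeta>\<^sup>2)"
        "cnj (g 0) * sampling_error \<epsilon> z N (\<lambda>\<zeta>. 1 / \<zeta>\<^sup>2)"] by simp
  also have "2 * B * Re (g 0) \<le> 2 * B * norm (g 0)"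
    using B complex_Re_le_cmod[of "g 0"] by (intro mult_left_mono) auto
  finally show ?thesis by (simp add: w_def algebra_simps)
qed

text \<open>The function g on the disc that corresponds to f may be wild at the boundary, but its dilations are holomorphic on
  the closed disc and have the same value at 0, which makes the bound independent of the dilation.\<close>

lemma norm_sampling_error_nevanlinna_le:
  assumes eps: "\<epsilon> > 0" and z: "Im z \<ge> \<epsilon>"
    and B1: "norm (sampling_error \<epsilon> z N (\<lambda>\<zeta>. 1 / \<zeta>\<^sup>2)) \<le> B"
    and B2: "\<And>t. t \<noteq> 0 \<Longrightarrow>
      norm (sampling_error \<epsilon> z N (\<lambda>\<zeta>. (1 + complex_of_real t * \<zeta>) / (of_real t - \<zeta>) / \<zeta>\<^sup>2)) \<le> B"
    and hol: "f holomorphic_on {\<zeta>. Im \<zeta> > 0}" and pos: "\<And>\<zeta>. Im \<zeta> > 0 \<Longrightarrow> Im (f \<zeta>) \<ge> 0"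
  shows "norm (sampling_error \<epsilon> z N (\<lambda>\<zeta>. f \<zeta> / \<zeta>\<^sup>2)) \<le> 3 * norm (f \<i>) * B"
proof -
  define g where "g = (\<lambda>v. - \<i> * f (\<i> * (1 + v) / (1 - v)))"
  define w where "w = (\<lambda>\<zeta>::complex. (\<zeta> - \<i>) / (\<zeta> + \<i>))"
  have g_hol: "g holomorphic_on ball 0 1"
    unfolding g_def
  proof (intro holomorphic_intros holomorphic_on_compose_gen[OF _ hol, unfolded o_def])
    show "(\<lambda>v. \<i> * (1 + v) / (1 - v)) ` ball 0 1 \<subseteq> {\<zeta>. 0 < Im \<zeta>}"
      using cayley_upper_half_plane by auto
  qed auto
  have g_pos: "Re (g v) \<ge> 0" if "norm v < 1" for v
    using pos[OF cayley_upper_half_plane[OF that]] by (simp add: g_def)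
  have g_w: "g (w \<zeta>) = - \<i> * f \<zeta>" if "Im \<zeta> > 0" for \<zeta>
    using cayley_inverse(2)[OF that] by (simp add: g_def w_def)
  have dilated: "norm (sampling_error \<epsilon> z N (\<lambda>\<zeta>. g (of_real r * w \<zeta>) / \<zeta>\<^sup>2)) \<le> 3 * norm (g 0) * B"
    if r: "0 < r" "r < 1" for r :: real
  proof -
    have small: "norm (of_real r * v) < 1" if "norm v \<le> 1" for v :: complex
    proof -
      have "r * norm v \<le> r * 1" using r that by (intro mult_left_mono) auto
      moreover have "norm (of_real r * v) = r * norm v" using r by (simp add: norm_mult)
      ultimately show ?thesis using r by linarith
    qed
    have "norm (sampling_error \<epsilon> z N (\<lambda>\<zeta>. (\<lambda>v. g (of_real r * v)) ((\<zeta> - \<i>) / (\<zeta> + \<i>)) / \<zeta>\<^sup>2))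
        \<le> 3 * norm ((\<lambda>v. g (of_real r * v)) 0) * B"
    proof (rule norm_sampling_error_positive_le[OF eps z B1 B2])
      show "(\<lambda>v. g (of_real r * v)) holomorphic_on cball 0 1"
        by (intro holomorphic_on_compose_gen[OF _ g_hol, unfolded o_def] holomorphic_intros)
           (use small in auto)
      show "0 \<le> Re (g (of_real r * v))" if "norm v = 1" for v
        using small[of v] that by (intro g_pos) auto
    qed
    then show ?thesis by (simp add: w_def)
  qed
  have "((\<lambda>r. sampling_error \<epsilon> z N (\<lambda>\<zeta>. g (of_real r * w \<zeta>) / \<zeta>\<^sup>2))
      \<longlongrightarrow> sampling_error \<epsilon> z N (\<lambda>\<zeta>. g (w \<zeta>) / \<zeta>\<^sup>2)) (at_left 1)"
  proof (rule sampling_error_tendsto[OF z])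
    fix \<zeta> :: complex assume \<zeta>: "\<epsilon> \<le> Im \<zeta>"
    then have "w \<zeta> \<in> ball 0 1" using cayley_inverse(1)[of \<zeta>] eps by (simp add: w_def)
    then have "isCont g (w \<zeta>)"
      using g_hol holomorphic_on_imp_continuous_on continuous_on_eq_continuous_at by blast
    moreover have "((\<lambda>r. of_real r * w \<zeta>) \<longlongrightarrow> of_real 1 * w \<zeta>) (at_left (1::real))"
      by (intro tendsto_intros)
    ultimately have "((\<lambda>r. g (of_real r * w \<zeta>)) \<longlongrightarrow> g (w \<zeta>)) (at_left (1::real))"
      using isCont_tendsto_compose by fastforce
    then show "((\<lambda>r. g (of_real r * w \<zeta>) / \<zeta>\<^sup>2) \<longlongrightarrow> g (w \<zeta>) / \<zeta>\<^sup>2) (at_left (1::real))"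
      using \<zeta> eps by (intro tendsto_divide tendsto_const) auto
  qed
  then have "norm (sampling_error \<epsilon> z N (\<lambda>\<zeta>. g (w \<zeta>) / \<zeta>\<^sup>2)) \<le> 3 * norm (g 0) * B"
  proof (intro tendsto_upperbound[OF tendsto_norm])
    have "\<forall>\<^sub>F r in at_left (1::real). r \<in> {0<..<1}" by (rule eventually_at_left_real) simp
    then show "\<forall>\<^sub>F r in at_left 1. norm (sampling_error \<epsilon> z N (\<lambda>\<zeta>. g (of_real r * w \<zeta>) / \<zeta>\<^sup>2)) \<le> 3 * norm (g 0) * B"
      by eventually_elim (use dilated in auto)
  qed auto
  moreover have "sampling_error \<epsilon> z N (\<lambda>\<zeta>. g (w \<zeta>) / \<zeta>\<^sup>2) = sampling_error \<epsilon> z N (\<lambda>\<zeta>. - \<i> * (f \<zeta> / \<zeta>\<^sup>2))"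
    by (rule sampling_error_cong[OF z]) (use eps g_w in auto)
  ultimately show ?thesis
    unfolding sampling_error_cmult by (simp add: g_def norm_mult)
qed

section \<open>Absolutely continuous functions\<close>

text \<open>The fundamental theorem of calculus for the gauge integral, with a null set of exceptional points. At the
  other points the usual straddle estimate holds. A tag in the exceptional set forces its interval into an open set T
  of small measure, and absolute continuity makes the increments over all of these intervals small together.\<close>

lemma absolutely_continuous_has_integral:
  fixes f :: "real \<Rightarrow> 'a::banach"
  assumes ac: "absolutely_continuous_on_interval a b f" and ab: "a \<le> b"
    and N: "negligible N"
    and deriv: "\<And>x. x \<in> {a<..<b} - N \<Longrightarrow> (f has_vector_derivative f' x) (at x)"
  shows "(f' has_integral (f b - f a)) {a..b}"
proof -
  define Z where "Z = N \<union> {a, b}"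
  \<comment> \<open>The value 0 on the null set removes the contribution of its tags to the Riemann sums.\<close>
  define g where "g = (\<lambda>x. if x \<in> Z then 0 else f' x)"
  have Z: "negligible Z" using N by (simp add: Z_def negligible_Un)
  have "(g has_integral (f b - f a)) {a..b}"
    unfolding has_integral_real
  proof (intro allI impI)
    fix e :: real assume e: "e > 0"
    define c where "c = e / (2 * (b - a + 1))"
    have c: "c > 0" "c * (b - a) < e / 2"
      using e ab by (auto simp: c_def field_simps)
    have "\<exists>\<delta>>0. x \<in> {a..b} - Z \<longrightarrow> (\<forall>y. \<bar>y - x\<bar> < \<delta> \<longrightarrow> norm (f y - f x - (y - x) *\<^sub>R f' x) \<le> c * \<bar>y - x\<bar>)" for x
    proof (cases "x \<in> {a..b} - Z")
      case True
      then have "(f has_vector_derivative f' x) (at x)" by (intro deriv) (auto simp: Z_def)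
      then show ?thesis
        unfolding has_vector_derivative_def has_derivative_within_alt using c by fastforce
    next
      case False
      then show ?thesis by (auto intro: exI[of _ 1])
    qed
    then obtain \<delta> where \<delta>: "\<And>x. \<delta> x > 0"
      "\<And>x y. x \<in> {a..b} - Z \<Longrightarrow> \<bar>y - x\<bar> < \<delta> x \<Longrightarrow> norm (f y - f x - (y - x) *\<^sub>R f' x) \<le> c * \<bar>y - x\<bar>"
      by metis
    obtain d where d: "d > 0" and dS: "\<And>S. finite S \<Longrightarrow> S \<subseteq> {(s, t). a \<le> s \<and> s \<le> t \<and> t \<le> b} \<Longrightarrow>
        disjoint_family_on (\<lambda>(s, t). {s<..<t}) S \<Longrightarrow> (\<Sum>(s, t)\<in>S. t - s) < d \<Longrightarrow>
        (\<Sum>(s, t)\<in>S. norm (f t - f s)) < e / 2"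
      using ac half_gt_zero[OF e] unfolding absolutely_continuous_on_interval_def by meson
    obtain T where T: "open T" "Z \<subseteq> T" "T - Z \<in> lmeasurable" "emeasure lebesgue (T - Z) < ennreal d"
      using sets_lebesgue_outer_open[OF negligible_imp_sets[OF Z] d] by metis
    have Tm: "T \<in> lmeasurable"
      using T(2,3) negligible_imp_measurable[OF Z] by (metis Diff_partition fmeasurable.Un sup_commute Un_Diff_cancel sup.absorb2)
    have "measure lebesgue T \<le> measure lebesgue (T - Z) + measure lebesgue Z"
      using measure_Un_le[of "T - Z" lebesgue Z] T(2,3) negligible_imp_sets[OF Z]
      by (simp add: Un_absorb2 fmeasurableD)
    also have "\<dots> < d"
      using T(3,4) negligible_imp_measure0[OF Z] d
      by (simp add: emeasure_eq_measure2 ennreal_less_iff)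
    finally have Td: "measure lebesgue T < d" .
    define \<gamma> where "\<gamma> = (\<lambda>x. if x \<in> Z then T else ball x (\<delta> x))"
    have "gauge \<gamma>" using T(1,2) \<delta>(1) by (auto simp: gauge_def \<gamma>_def)
    moreover have "norm ((\<Sum>(x, k)\<in>p. measure lborel k *\<^sub>R g x) - (f b - f a)) < e"
      if p: "p tagged_division_of {a..b}" "\<gamma> fine p" for p
    proof -
      have fin: "finite p" using tagged_division_of_finite[OF p(1)] .
      have iv: "\<exists>u v. k = {u..v} \<and> u \<le> v \<and> a \<le> u \<and> v \<le> b \<and> x \<in> {u..v}" if xkp: "(x, k) \<in> p" for x k
      proof -
        obtain u v where k: "k = cbox u v" using tagged_division_ofD(4)[OF p(1) xkp] by blast
        have xk: "x \<in> k" "k \<subseteq> {a..b}" using tagged_division_ofD(2,3)[OF p(1) xkp] by auto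
        then have uv: "u \<le> v" using k by auto
        then have "u \<in> k" "v \<in> k" using k by auto
        then have "a \<le> u" "v \<le> b" using xk(2) by auto
        then show ?thesis using xk(1) k uv by auto
      qed
      define A where "A = {q \<in> p. fst q \<in> Z}"
      define h where "h = (\<lambda>(x, k). measure lborel k *\<^sub>R g x - (f (Sup k) - f (Inf k)))"
      have "(\<Sum>(x, k)\<in>p. measure lborel k *\<^sub>R g x) - (f b - f a) = (\<Sum>q\<in>p. h q)"
        using additive_tagged_division_1[OF ab p(1), of f]
        by (simp add: h_def case_prod_unfold sum_subtractf)
      also have "\<dots> = (\<Sum>q\<in>A. h q) + (\<Sum>q\<in>p - A. h q)"
        using fin by (subst sum.subset_diff[of A]) (auto simp: A_def add.commute)
      finally have split: "(\<Sum>(x, k)\<in>p. measure lborel k *\<^sub>R g x) - (f b - f a) = (\<Sum>q\<in>A. h q) + (\<Sum>q\<in>p - A. h q)" .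
      have "norm (\<Sum>q\<in>p - A. h q) \<le> (\<Sum>q\<in>p - A. c * measure lborel (snd q))"
      proof (rule sum_norm_le)
        fix q assume q: "q \<in> p - A"
        obtain x k where xk: "q = (x, k)" by force
        with q have xkp: "(x, k) \<in> p" "x \<notin> Z" by (auto simp: A_def)
        obtain u v where uv: "k = {u..v}" "u \<le> v" "a \<le> u" "v \<le> b" "u \<le> x" "x \<le> v"
          using iv[OF xkp(1)] by auto
        have "k \<subseteq> ball x (\<delta> x)" using fineD[OF p(2) xkp(1)] xkp(2) by (simp add: \<gamma>_def)
        moreover have "u \<in> k" "v \<in> k" using uv(1,2) by auto
        ultimately have "u \<in> ball x (\<delta> x)" "v \<in> ball x (\<delta> x)" by blast+
        then have uvx: "\<bar>u - x\<bar> < \<delta> x" "\<bar>v - x\<bar> < \<delta> x"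
          by (auto simp: dist_real_def abs_minus_commute)
        have x: "x \<in> {a..b} - Z" using uv xkp by auto
        have "h q = (f u - f x - (u - x) *\<^sub>R f' x) - (f v - f x - (v - x) *\<^sub>R f' x)"
          using xkp(2) uv(1,2) by (simp add: h_def xk g_def algebra_simps)
        also have "norm \<dots> \<le> c * \<bar>u - x\<bar> + c * \<bar>v - x\<bar>"
          by (intro norm_triangle_le_diff add_mono \<delta>(2) x uvx)
        also have "\<dots> = c * measure lborel (snd q)" using uv by (simp add: xk algebra_simps)
        finally show "norm (h q) \<le> c * measure lborel (snd q)" .
      qed
      also have "\<dots> \<le> (\<Sum>q\<in>p. c * measure lborel (snd q))"
        using fin c by (intro sum_mono2) auto
      also have "\<dots> = c * (b - a)"
        using additive_content_tagged_division[of p a b] p(1) ab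
        by (simp add: sum_distrib_left[symmetric] case_prod_unfold)
      finally have B: "norm (\<Sum>q\<in>p - A. h q) < e / 2" using c by simp
      define S where "S = (\<lambda>(x, k). (Inf k, Sup k)) ` A"
      have inj: "inj_on (\<lambda>(x, k). (Inf k, Sup k)) A"
      proof (rule inj_onI, clarify)
        fix x k x' k' assume as: "(x, k) \<in> A" "(x', k') \<in> A" and eq: "Inf k = Inf k'" "Sup k = Sup k'"
        have "(x, k) \<in> p" "(x', k') \<in> p" using as by (auto simp: A_def)
        obtain u v where uv: "k = {u..v}" "u \<le> v" "x \<in> {u..v}" using iv[OF \<open>(x, k) \<in> p\<close>] by auto
        obtain u' v' where uv': "k' = {u'..v'}" "u' \<le> v'" "x' \<in> {u'..v'}" using iv[OF \<open>(x', k') \<in> p\<close>] by auto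
        have same: "u = u'" "v = v'" using eq uv uv' by auto
        show "x = x' \<and> k = k'"
        proof (cases "u = v")
          case True
          then show ?thesis using same uv uv' by auto
        next
          case False
          then have "interior k \<inter> interior k' \<noteq> {}" using uv uv' same by (simp add: interior_atLeastAtMost_real)
          then have "(x, k) = (x', k')"
            using tagged_division_ofD(5)[OF p(1) \<open>(x, k) \<in> p\<close> \<open>(x', k') \<in> p\<close>] by blast
          then show ?thesis by simp
        qed
      qed
      have Apart: "A tagged_partial_division_of {a..b}"
        using p(1) tagged_partial_division_subset[of p "{a..b}" A]
        by (auto simp: A_def tagged_division_of_def)
      have Atag: "A tagged_division_of \<Union> (snd ` A)"
        by (rule tagged_partial_division_of_Union_self[OF Apart])
      have "(\<Sum>(s, t)\<in>S. t - s) = (\<Sum>(x, k)\<in>A. Sup k - Inf k)"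
        unfolding S_def by (subst sum.reindex[OF inj]) (simp add: case_prod_unfold)
      also have "\<dots> = (\<Sum>(x, k)\<in>A. measure lborel k)"
      proof (intro sum.cong refl, clarify)
        fix x k assume "(x, k) \<in> A"
        then have "(x, k) \<in> p" by (simp add: A_def)
        then obtain u v where "k = {u..v}" "u \<le> v" using iv by blast
        then show "Sup k - Inf k = measure lborel k" by simp
      qed
      also have "\<dots> = (\<Sum>k\<in>snd ` A. measure lborel k)"
        by (rule sum.over_tagged_division_lemma[OF Atag]) (simp add: content_eq_0_interior)
      also have "\<dots> = (\<Sum>k\<in>snd ` A. measure lebesgue k)"
      proof (intro sum.cong refl, clarify)
        fix x k assume "(x, k) \<in> A"
        then have "(x, k) \<in> p" by (simp add: A_def)
        then obtain u v where "k = {u..v}" "u \<le> v" using iv by blast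
        then show "measure lborel (snd (x, k)) = measure lebesgue (snd (x, k))" by simp
      qed
      also have "\<dots> = measure lebesgue (\<Union> (snd ` A))"
        by (rule content_division[OF division_of_tagged_division[OF Atag]])
      also have "\<dots> \<le> measure lebesgue T"
      proof (rule measure_mono_fmeasurable[OF _ _ Tm])
        show "\<Union> (snd ` A) \<subseteq> T"
        proof clarify
          fix y x k assume "(x, k) \<in> A" "y \<in> snd (x, k)"
          then show "y \<in> T" using fineD[OF p(2), of x k] by (auto simp: A_def \<gamma>_def)
        qed
        show "\<Union> (snd ` A) \<in> sets lebesgue"
          using lmeasurable_division[OF division_of_tagged_division[OF Atag]] by auto
      qed
      finally have len: "(\<Sum>(s, t)\<in>S. t - s) < d" using Td by simp
      have "(\<Sum>(s, t)\<in>S. norm (f t - f s)) < e / 2"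
      proof (rule dS[OF _ _ _ len])
        show "finite S" using fin by (simp add: S_def A_def)
        show "S \<subseteq> {(s, t). a \<le> s \<and> s \<le> t \<and> t \<le> b}"
        proof
          fix q assume "q \<in> S"
          then obtain x k where xk: "(x, k) \<in> p" "q = (Inf k, Sup k)" by (auto simp: S_def A_def)
          obtain u v where "k = {u..v}" "u \<le> v" "a \<le> u" "v \<le> b" using iv[OF xk(1)] by auto
          then show "q \<in> {(s, t). a \<le> s \<and> s \<le> t \<and> t \<le> b}" using xk(2) by simp
        qed
        show "disjoint_family_on (\<lambda>(s, t). {s<..<t}) S"
          unfolding disjoint_family_on_def
        proof (intro ballI impI)
          fix m n assume mn: "m \<in> S" "n \<in> S" "m \<noteq> n"
          then obtain x k x' k' where q: "(x, k) \<in> A" "(x', k') \<in> A" "m = (Inf k, Sup k)" "n = (Inf k', Sup k')"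
            by (auto simp: S_def)
          then have qp: "(x, k) \<in> p" "(x', k') \<in> p" by (auto simp: A_def)
          have "interior k \<inter> interior k' = {}"
            using tagged_division_ofD(5)[OF p(1) qp] mn(3) q(3,4) by auto
          moreover obtain u v where uv: "k = {u..v}" "u \<le> v" using iv[OF qp(1)] by auto
          moreover obtain u' v' where uv': "k' = {u'..v'}" "u' \<le> v'" using iv[OF qp(2)] by auto
          ultimately show "(case m of (s, t) \<Rightarrow> {s<..<t}) \<inter> (case n of (s, t) \<Rightarrow> {s<..<t}) = {}"
            using q(3,4) by (simp add: interior_atLeastAtMost_real)
        qed
      qed
      also have "(\<Sum>(s, t)\<in>S. norm (f t - f s)) = (\<Sum>q\<in>A. norm (h q))"
        unfolding S_def by (subst sum.reindex[OF inj])
          (auto intro!: sum.cong simp: h_def g_def A_def norm_minus_commute)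
      finally have "norm (\<Sum>q\<in>A. h q) < e / 2" using norm_sum[of h A] by linarith
      with B show ?thesis
        unfolding split using norm_triangle_ineq[of "\<Sum>q\<in>A. h q" "\<Sum>q\<in>p - A. h q"] by linarith
    qed
    ultimately show "\<exists>\<gamma>. gauge \<gamma> \<and> (\<forall>p. p tagged_division_of {a..b} \<and> \<gamma> fine p \<longrightarrow>
        norm ((\<Sum>(x, k)\<in>p. measure lborel k *\<^sub>R g x) - (f b - f a)) < e)"
      by (intro exI[of _ \<gamma>] conjI allI impI) auto
  qed
  then show ?thesis
    by (rule has_integral_spike[OF Z, rotated]) (simp add: g_def)
qed

lemma absolutely_continuous_imp_continuous_on:
  fixes f :: "real \<Rightarrow> 'a::real_normed_vector"
  assumes "absolutely_continuous_on_interval a b f"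
  shows "continuous_on {a..b} f"
  unfolding continuous_on_iff
proof (intro ballI allI impI)
  fix x e :: real assume x: "x \<in> {a..b}" and e: "e > 0"
  obtain d where d: "d > 0" and dS: "\<And>S. finite S \<Longrightarrow> S \<subseteq> {(s, t). a \<le> s \<and> s \<le> t \<and> t \<le> b} \<Longrightarrow>
        disjoint_family_on (\<lambda>(s, t). {s<..<t}) S \<Longrightarrow> (\<Sum>(s, t)\<in>S. t - s) < d \<Longrightarrow>
        (\<Sum>(s, t)\<in>S. norm (f t - f s)) < e"
    using assms e unfolding absolutely_continuous_on_interval_def by meson
  have "dist (f y) (f x) < e" if y: "y \<in> {a..b}" "dist y x < d" for y
  proof -
    have "(\<Sum>(s, t)\<in>{(min x y, max x y)}. norm (f t - f s)) < e"
      using x y by (intro dS) (auto simp: disjoint_family_on_def dist_real_def)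
    then show ?thesis by (auto simp: dist_norm min_def max_def norm_minus_commute split: if_splits)
  qed
  then show "\<exists>d>0. \<forall>y\<in>{a..b}. dist y x < d \<longrightarrow> dist (f y) (f x) < e" using d by blast
qed

lemma (in bounded_bilinear) absolutely_continuous_on_interval:
  assumes f: "absolutely_continuous_on_interval a b f" and g: "absolutely_continuous_on_interval a b g"
  shows "absolutely_continuous_on_interval a b (\<lambda>x. prod (f x) (g x))"
proof -
  have "bounded (f ` {a..b})" "bounded (g ` {a..b})"
    using f g by (auto intro!: compact_imp_bounded compact_continuous_image absolutely_continuous_imp_continuous_on)
  then obtain F G where FG: "F > 0" "G > 0" "\<And>x. x \<in> {a..b} \<Longrightarrow> norm (f x) \<le> F" "\<And>x. x \<in> {a..b} \<Longrightarrow> norm (g x) \<le> G"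
    by (fastforce simp: bounded_pos)
  obtain K where K: "K > 0" "\<And>u v. norm (prod u v) \<le> norm u * norm v * K"
    using pos_bounded by blast
  show ?thesis
    unfolding absolutely_continuous_on_interval_def
  proof (intro allI impI)
    fix e :: real assume e: "e > 0"
    define e1 e2 where "e1 = e / (2 * G * K)" and "e2 = e / (2 * F * K)"
    have e12: "e1 > 0" "e2 > 0" using e FG K by (auto simp: e1_def e2_def)
    obtain d1 where d1: "d1 > 0" "\<And>S. finite S \<and> S \<subseteq> {(s, t). a \<le> s \<and> s \<le> t \<and> t \<le> b} \<and>
        disjoint_family_on (\<lambda>(s, t). {s<..<t}) S \<and> (\<Sum>(s, t)\<in>S. t - s) < d1 \<Longrightarrow>
        (\<Sum>(s, t)\<in>S. norm (f t - f s)) < e1"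
      using f e12(1) unfolding absolutely_continuous_on_interval_def by meson
    obtain d2 where d2: "d2 > 0" "\<And>S. finite S \<and> S \<subseteq> {(s, t). a \<le> s \<and> s \<le> t \<and> t \<le> b} \<and>
        disjoint_family_on (\<lambda>(s, t). {s<..<t}) S \<and> (\<Sum>(s, t)\<in>S. t - s) < d2 \<Longrightarrow>
        (\<Sum>(s, t)\<in>S. norm (g t - g s)) < e2"
      using g e12(2) unfolding absolutely_continuous_on_interval_def by meson
    show "\<exists>d>0. \<forall>S. finite S \<and> S \<subseteq> {(s, t). a \<le> s \<and> s \<le> t \<and> t \<le> b} \<and>
        disjoint_family_on (\<lambda>(s, t). {s<..<t}) S \<and> (\<Sum>(s, t)\<in>S. t - s) < d \<longrightarrow>
        (\<Sum>(s, t)\<in>S. norm (prod (f t) (g t) - prod (f s) (g s))) < e"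
    proof (rule exI[of _ "min d1 d2"], intro conjI allI impI)
      fix S assume S: "finite S \<and> S \<subseteq> {(s, t). a \<le> s \<and> s \<le> t \<and> t \<le> b} \<and>
        disjoint_family_on (\<lambda>(s, t). {s<..<t}) S \<and> (\<Sum>(s, t)\<in>S. t - s) < min d1 d2"
      have "(\<Sum>(s, t)\<in>S. norm (prod (f t) (g t) - prod (f s) (g s)))
          \<le> (\<Sum>q\<in>S. G * K * (case q of (s, t) \<Rightarrow> norm (f t - f s)) + F * K * (case q of (s, t) \<Rightarrow> norm (g t - g s)))"
      proof (rule sum_mono, clarify)
        fix s t assume "(s, t) \<in> S"
        then have st: "s \<in> {a..b}" "t \<in> {a..b}" using S by force+
        have "prod (f t) (g t) - prod (f s) (g s) = prod (f t - f s) (g t) + prod (f s) (g t - g s)"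
          by (simp add: diff_left diff_right)
        also have "norm \<dots> \<le> norm (f t - f s) * norm (g t) * K + norm (f s) * norm (g t - g s) * K"
          by (intro norm_triangle_le add_mono K(2))
        also have "\<dots> \<le> norm (f t - f s) * G * K + F * norm (g t - g s) * K"
          using FG K(1) st by (intro add_mono mult_right_mono mult_left_mono) auto
        finally show "norm (prod (f t) (g t) - prod (f s) (g s)) \<le> G * K * norm (f t - f s) + F * K * norm (g t - g s)"
          by (simp add: mult_ac)
      qed
      also have "\<dots> = G * K * (\<Sum>(s, t)\<in>S. norm (f t - f s)) + F * K * (\<Sum>(s, t)\<in>S. norm (g t - g s))"
        by (simp add: sum.distrib sum_distrib_left)
      also have "\<dots> < G * K * e1 + F * K * e2"
        using d1(2)[of S] d2(2)[of S] S FG K(1) by (intro add_strict_mono mult_strict_left_mono) auto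
      also have "\<dots> = e" using FG K(1) by (simp add: e1_def e2_def)
      finally show "(\<Sum>(s, t)\<in>S. norm (prod (f t) (g t) - prod (f s) (g s))) < e" .
    qed (use d1(1) d2(1) in auto)
  qed
qed

section \<open>The conserved form of the Dirac system\<close>

definition cip :: "complex^'n \<Rightarrow> complex^'n \<Rightarrow> complex"
  where "cip a b = (\<Sum>i\<in>UNIV. a $ i * cnj (b $ i))"

lemma cip_add_left: "cip (a + b) c = cip a c + cip b c"
  and cip_add_right: "cip a (b + c) = cip a b + cip a c"
  and cip_diff_left: "cip (a - b) c = cip a c - cip b c"
  and cip_diff_right: "cip a (b - c) = cip a b - cip a c"
  by (simp_all add: cip_def algebra_simps sum.distrib sum_subtractf)

lemma cip_scale_left: "cip (k *s a) b = k * cip a b"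
  and cip_scale_right: "cip a (k *s b) = cnj k * cip a b"
  and cip_scaleR_left: "cip (r *\<^sub>R a) b = of_real r * cip a b"
  and cip_scaleR_right: "cip a (r *\<^sub>R b) = of_real r * cip a b"
  and cip_minus_left: "cip (- a) b = - cip a b"
  and cip_minus_right: "cip a (- b) = - cip a b"
  by (simp_all add: cip_def sum_distrib_left sum_negf mult_ac scaleR_conv_of_real[where 'a=complex])

lemmas cip_linear = cip_add_left cip_add_right cip_diff_left cip_diff_right cip_scale_left cip_scale_right
  cip_scaleR_left cip_scaleR_right cip_minus_left cip_minus_right

lemma cip_commute: "cip b a = cnj (cip a b)"
  by (simp add: cip_def mult.commute)

lemma cip_self: "cip a a = of_real ((norm a)\<^sup>2)"
proof -
  have "(norm a)\<^sup>2 = (\<Sum>i\<in>UNIV. (norm (a $ i))\<^sup>2)"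
    by (simp add: norm_vec_def L2_set_def sum_nonneg)
  then show ?thesis by (simp add: cip_def complex_norm_square[symmetric])
qed

text \<open>The weighted form of the Cauchy-Schwarz inequality, which survives integration without further work.\<close>

lemma norm_cip_le:
  assumes "\<kappa> > 0"
  shows "norm (cip a b) \<le> (\<kappa> * (norm a)\<^sup>2 + (norm b)\<^sup>2 / \<kappa>) / 2"
proof -
  have "norm (cip a b) \<le> (\<Sum>i\<in>UNIV. norm (a $ i) * norm (b $ i))"
    unfolding cip_def by (rule sum_norm_le) (simp add: norm_mult)
  also have "\<dots> \<le> (\<Sum>i\<in>UNIV. (\<kappa> * (norm (a $ i))\<^sup>2 + (norm (b $ i))\<^sup>2 / \<kappa>) / 2)"
  proof (rule sum_mono)
    fix i
    have "0 \<le> (\<kappa> * norm (a $ i) - norm (b $ i))\<^sup>2 / \<kappa>" using assms by simp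
    also have "\<dots> = \<kappa> * (norm (a $ i))\<^sup>2 + (norm (b $ i))\<^sup>2 / \<kappa> - 2 * (norm (a $ i) * norm (b $ i))"
      using assms by (simp add: field_simps power2_eq_square)
    finally show "norm (a $ i) * norm (b $ i) \<le> (\<kappa> * (norm (a $ i))\<^sup>2 + (norm (b $ i))\<^sup>2 / \<kappa>) / 2" by simp
  qed
  also have "\<dots> = (\<kappa> * (\<Sum>i\<in>UNIV. (norm (a $ i))\<^sup>2) + (\<Sum>i\<in>UNIV. (norm (b $ i))\<^sup>2) / \<kappa>) / 2"
    by (simp add: sum.distrib sum_distrib_left flip: sum_divide_distrib)
  also have "\<dots> = (\<kappa> * (norm a)\<^sup>2 + (norm b)\<^sup>2 / \<kappa>) / 2"
    by (simp add: norm_vec_def L2_set_def sum_nonneg)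
  finally show ?thesis .
qed

lemma cip_adjoint: "cip (A *v a) b = cip a (conj_transpose A *v b)"
proof -
  have "cip (A *v a) b = (\<Sum>i\<in>UNIV. \<Sum>j\<in>UNIV. A $ i $ j * a $ j * cnj (b $ i))"
    by (simp add: cip_def matrix_vector_mult_def sum_distrib_right)
  also have "\<dots> = (\<Sum>j\<in>UNIV. \<Sum>i\<in>UNIV. A $ i $ j * a $ j * cnj (b $ i))"
    by (rule sum.swap)
  also have "\<dots> = cip a (conj_transpose A *v b)"
    by (simp add: cip_def matrix_vector_mult_def conj_transpose_def transpose_def map_matrix_def
        sum_distrib_left mult_ac)
  finally show ?thesis .
qed

lemma conj_transpose_twice [simp]: "conj_transpose (conj_transpose A) = A"
  by (simp add: conj_transpose_def transpose_def map_matrix_def vec_eq_iff)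

lemma scaleR_mult_vec: "(r *\<^sub>R A) *v x = r *\<^sub>R (A *v x)"
  and mult_vec_scaleR: "A *v (r *\<^sub>R x) = r *\<^sub>R (A *v x)"
  for A :: "complex^'n^'m" and x :: "complex^'n"
  by (simp_all add: vec_eq_iff matrix_vector_mult_def scaleR_sum_right scaleR_conv_of_real[where 'a=complex] mult_ac sum_distrib_left)

lemma bounded_bilinear_cip_matrix:
  fixes J :: "complex^'n^'n"
  shows "bounded_bilinear (\<lambda>P Q. cip (J *v ((P :: complex^'n^'n) *v a)) ((Q :: complex^'n^'n) *v b))"
  by (subst bilinear_conv_bounded_bilinear[symmetric], unfold bilinear_def)
     (auto intro!: linearI simp: cip_linear matrix_vector_mult_add_rdistrib matrix_vector_right_distrib
        scaleR_mult_vec mult_vec_scaleR scaleR_conv_of_real[where 'a=complex])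

definition block_vec :: "complex^'n \<Rightarrow> complex^'k \<Rightarrow> complex^('n + 'k)"
  where "block_vec a b = (\<chi> i. case i of Inl l \<Rightarrow> a $ l | Inr r \<Rightarrow> b $ r)"

lemma sum_UNIV_Plus:
  fixes f :: "'a::finite + 'b::finite \<Rightarrow> 'c::comm_monoid_add"
  shows "(\<Sum>i\<in>UNIV. f i) = (\<Sum>l\<in>UNIV. f (Inl l)) + (\<Sum>r\<in>UNIV. f (Inr r))"
  unfolding UNIV_Plus_UNIV[symmetric] by (simp add: sum.Plus del: UNIV_Plus_UNIV)

lemma cip_block_vec: "cip (block_vec a b) (block_vec c d) = cip a c + cip b d"
  by (simp add: cip_def block_vec_def sum_UNIV_Plus)

lemma block_vec_cases: obtains b c where "a = block_vec b c"
proof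
  show "a = block_vec (\<chi> l. a $ Inl l) (\<chi> r. a $ Inr r)"
    by (auto simp: block_vec_def vec_eq_iff split: sum.split)
qed

lemma block_mat_mult_block_vec:
  "block_mat A B C D *v block_vec a b = block_vec (A *v a + B *v b) (C *v a + D *v b)"
  by (auto simp: block_mat_def block_col_def block_row_def block_vec_def vec_eq_iff
      matrix_vector_mult_def sum_UNIV_Plus split: sum.split)

lemma block_col_mult_vec: "block_col A B *v a = block_vec (A *v a) (B *v a)"
  by (auto simp: block_col_def block_vec_def vec_eq_iff matrix_vector_mult_def split: sum.split)

lemma cscale_mult_vec: "(k *\<^sub>C A) *v a = k *s (A *v a)"
  by (simp add: cscale_def map_matrix_def vec_eq_iff matrix_vector_mult_def sum_distrib_left mult_ac)

lemma minus_mult_vec: "(- A) *v a = - (A *v a)" for A :: "complex^'n^'m"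
  by (simp add: vec_eq_iff matrix_vector_mult_def sum_negf)

lemma conj_transpose_block_col:
  "conj_transpose (block_col A B) = block_row (conj_transpose A) (conj_transpose B)"
  by (auto simp: conj_transpose_def transpose_def map_matrix_def block_col_def block_row_def vec_eq_iff
      split: sum.split)

lemma conj_transpose_weyl_column:
  "conj_transpose (block_col (mat 1) (- (\<i> *\<^sub>C P))) = block_row (mat 1) (\<i> *\<^sub>C conj_transpose P)"
  unfolding conj_transpose_block_col
  by (auto simp: conj_transpose_def transpose_def map_matrix_def vec_eq_iff cscale_def mat_def
      block_row_def split: sum.split)

lemma dirac_j_mult: "dirac_j *v block_vec a b = block_vec a (- b)"
  by (simp add: dirac_j_def block_mat_mult_block_vec minus_mult_vec)

lemma dirac_j_involution: "dirac_j *v (dirac_j *v a) = a"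
  by (cases a rule: block_vec_cases) (simp add: dirac_j_mult)

lemma cip_dirac_j: "cip (dirac_j *v a) b = cip a (dirac_j *v b)"
  by (cases a rule: block_vec_cases; cases b rule: block_vec_cases)
     (simp add: dirac_j_mult cip_block_vec cip_linear)

lemma cip_dirac_V: "cip (dirac_V w *v a) b = cip a (dirac_V w *v b)"
  by (cases a rule: block_vec_cases; cases b rule: block_vec_cases)
     (simp add: dirac_V_def block_mat_mult_block_vec cip_block_vec cip_adjoint)

text \<open>The derivative of the form along two solutions: the Hermitian potential drops out, and the spectral parameters
  contribute i z and - i cnj \<zeta>.\<close>

lemma dirac_current_derivative:
  fixes w :: "complex^'p^'p" and a b :: "complex^('p::finite + 'p)"
  shows "cip (dirac_j *v (\<i> *s (z *s (dirac_j *v a) + dirac_j *v (dirac_V w *v a)))) b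
     + cip (dirac_j *v a) (\<i> *s (\<zeta> *s (dirac_j *v b) + dirac_j *v (dirac_V w *v b)))
     = \<i> * (z - cnj \<zeta>) * cip a b"
proof -
  have 1: "dirac_j *v (\<i> *s (z *s (dirac_j *v a) + dirac_j *v (dirac_V w *v a)))
      = \<i> *s (z *s a + dirac_V w *v a)"
    by (simp add: matrix_vector_right_distrib vector_scalar_commute dirac_j_involution)
  have 2: "cip (dirac_j *v a) (\<i> *s (\<zeta> *s (dirac_j *v b) + dirac_j *v (dirac_V w *v b)))
      = - \<i> * (cnj \<zeta> * cip a b + cip a (dirac_V w *v b))"
    by (simp add: cip_linear cip_dirac_j dirac_j_involution algebra_simps)
  show ?thesis
    unfolding 1 2 by (simp add: cip_linear cip_dirac_V algebra_simps)
qed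

text \<open>The normalization U turns the form j into the off-diagonal form [0 I; I 0], for which the columns
  [I; - i P] and [I; - i Q] pair to i (Q^* - P).\<close>

lemma dirac_initial_current:
  fixes P Q :: "complex^'p^'p" and \<xi> :: "complex^'p"
  defines "U \<equiv> (1 / sqrt 2) *\<^sub>R block_mat (mat 1) (mat 1) (- mat 1) (mat 1) :: complex^('p + 'p)^('p + 'p)"
  shows "cip (dirac_j *v (U *v (block_col (mat 1) (- (\<i> *\<^sub>C P)) *v \<xi>))) (U *v (block_col (mat 1) (- (\<i> *\<^sub>C Q)) *v \<xi>))
    = - (\<i> * (cip (P *v \<xi>) \<xi> - cnj (cip (Q *v \<xi>) \<xi>)))"
proof -
  have U: "U *v (block_col (mat 1) (- (\<i> *\<^sub>C R)) *v \<xi>)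
      = (1 / sqrt 2) *\<^sub>R block_vec (\<xi> - \<i> *s (R *v \<xi>)) (- \<xi> - \<i> *s (R *v \<xi>))" for R
    by (simp add: U_def block_col_mult_vec block_mat_mult_block_vec minus_mult_vec cscale_mult_vec
        scaleR_mult_vec)
  have half: "complex_of_real (1 / sqrt 2) * (of_real (1 / sqrt 2) * x) = x / 2" for x
    by (simp add: field_simps flip: of_real_mult)
  show ?thesis
    unfolding U mult_vec_scaleR dirac_j_mult cip_scaleR_left cip_scaleR_right half cip_block_vec
    using cip_commute[of "Q *v \<xi>" \<xi>]
    by (simp add: cip_linear field_simps)
qed

lemma integral_tendsto_at_top:
  fixes f :: "real \<Rightarrow> 'b::euclidean_space"
  assumes "f absolutely_integrable_on {0..}"
  shows "((\<lambda>l. integral {0..l} f) \<longlongrightarrow> integral {0..} f) at_top"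
  using tendsto_set_lebesgue_integral_at_top[OF _ assms]
    set_lebesgue_integral_eq_integral(2)[OF assms]
    set_lebesgue_integral_eq_integral(2)[OF set_integrable_subset[OF assms], of "{0..l}" for l]
  by (auto simp: subset_eq)

text \<open>A nonzero limit would bound the integrals of h over unit intervals from below, but these tend to 0.\<close>

lemma limit_zero_of_integrable_bound:
  fixes G :: "real \<Rightarrow> complex" and h :: "real \<Rightarrow> real"
  assumes lim: "(G \<longlongrightarrow> L) at_top"
    and bound: "\<And>x. x \<ge> 0 \<Longrightarrow> norm (G x) \<le> h x"
    and int: "h absolutely_integrable_on {0..}"
  shows "L = 0"
proof (rule ccontr)
  assume "L \<noteq> 0"
  have int_on: "h integrable_on {0..l}" for l
    using integrable_on_subinterval[OF set_lebesgue_integral_eq_integral(1)[OF int], of 0 l] by auto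
  have I: "(\<lambda>n. integral {0..real n} h) \<longlonglongrightarrow> integral {0..} h"
    by (rule filterlim_compose[OF integral_tendsto_at_top[OF int] filterlim_real_sequentially])
  have "(\<lambda>n. integral {0..real (Suc n)} h - integral {0..real n} h) \<longlonglongrightarrow> integral {0..} h - integral {0..} h"
    by (intro tendsto_diff LIMSEQ_Suc[OF I] I)
  then have small: "(\<lambda>n. integral {0..real (Suc n)} h - integral {0..real n} h) \<longlonglongrightarrow> 0" by simp
  have "((\<lambda>x. norm (G x)) \<longlongrightarrow> norm L) at_top" by (intro tendsto_norm lim)
  then have "\<forall>\<^sub>F x in at_top. norm (G x) > norm L / 2"
    by (rule order_tendstoD(1)) (use \<open>L \<noteq> 0\<close> in auto)
  then obtain x0 where x0: "\<And>x. x \<ge> x0 \<Longrightarrow> norm (G x) > norm L / 2"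
    by (auto simp: eventually_at_top_linorder)
  have "\<forall>\<^sub>F n in sequentially. integral {0..real (Suc n)} h - integral {0..real n} h < norm L / 2"
    using small by (rule order_tendstoD(2)) (use \<open>L \<noteq> 0\<close> in auto)
  then obtain n1 where n1: "\<And>n. n \<ge> n1 \<Longrightarrow> integral {0..real (Suc n)} h - integral {0..real n} h < norm L / 2"
    by (auto simp: eventually_sequentially)
  define n where "n = max n1 (nat \<lceil>x0\<rceil>)"
  have n: "n \<ge> n1" "real n \<ge> x0" by (auto simp: n_def intro: order_trans[OF real_nat_ceiling_ge])
  have sub: "h integrable_on {real n..real (Suc n)}"
    by (rule integrable_on_subinterval[OF set_lebesgue_integral_eq_integral(1)[OF int]]) auto
  have "norm L / 2 = integral {real n..real (Suc n)} (\<lambda>x. norm L / 2)" by simp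
  also have "\<dots> \<le> integral {real n..real (Suc n)} h"
  proof (rule integral_le[OF _ sub])
    fix x assume x: "x \<in> {real n..real (Suc n)}"
    then have "norm (G x) > norm L / 2" "norm (G x) \<le> h x" using n x0[of x] bound[of x] by auto
    then show "norm L / 2 \<le> h x" by simp
  qed auto
  also have "\<dots> = integral {0..real (Suc n)} h - integral {0..real n} h"
    using Henstock_Kurzweil_Integration.integral_combine[OF _ _ int_on, of "real n" "real (Suc n)"] by simp
  also have "\<dots> < norm L / 2" using n1 n by simp
  finally show False by simp
qed

section \<open>Analyticity from a positive kernel\<close>

definition square_integrable :: "(real \<Rightarrow> complex^'n) \<Rightarrow> bool"
  where "square_integrable f \<longleftrightarrow> continuous_on {0..} f \<and> (\<lambda>x. (norm (f x))\<^sup>2) integrable_on {0..}"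

definition ip :: "(real \<Rightarrow> complex^'n) \<Rightarrow> (real \<Rightarrow> complex^'n) \<Rightarrow> complex"
  where "ip f g = integral {0..} (\<lambda>x. cip (f x) (g x))"

definition norm_sq :: "(real \<Rightarrow> complex^'n) \<Rightarrow> real"
  where "norm_sq f = integral {0..} (\<lambda>x. (norm (f x))\<^sup>2)"

lemma continuous_on_cip [continuous_intros]:
  "continuous_on S f \<Longrightarrow> continuous_on S g \<Longrightarrow> continuous_on S (\<lambda>x. cip (f x) (g x))"
  unfolding cip_def by (intro continuous_intros)

lemma absolutely_integrable_cip:
  assumes "square_integrable f" "square_integrable g"
  shows "(\<lambda>x. cip (f x) (g x)) absolutely_integrable_on {0..}"
proof (rule measurable_bounded_by_integrable_imp_absolutely_integrable)
  show "(\<lambda>x. cip (f x) (g x)) \<in> borel_measurable (lebesgue_on {0..})"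
    using assms by (intro continuous_imp_measurable_on_sets_lebesgue continuous_intros)
      (auto simp: square_integrable_def)
  show "(\<lambda>x. ((norm (f x))\<^sup>2 + (norm (g x))\<^sup>2) / 2) integrable_on {0..}"
    using assms by (intro integrable_on_divide integrable_add) (auto simp: square_integrable_def)
  show "norm (cip (f x) (g x)) \<le> ((norm (f x))\<^sup>2 + (norm (g x))\<^sup>2) / 2" for x
    using norm_cip_le[of 1 "f x" "g x"] by simp
qed auto

lemma integrable_cip:
  "square_integrable f \<Longrightarrow> square_integrable g \<Longrightarrow> (\<lambda>x. cip (f x) (g x)) integrable_on {0..}"
  using absolutely_integrable_cip set_lebesgue_integral_eq_integral(1) by blast

lemma square_integrable_scale:
  assumes "square_integrable f"
  shows "square_integrable (\<lambda>x. k *s f x)"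
proof -
  have n: "(norm (k *s a))\<^sup>2 = (norm k)\<^sup>2 * (norm a)\<^sup>2" for a :: "complex^'n"
  proof -
    have "complex_of_real ((norm (k *s a))\<^sup>2) = k * cnj k * of_real ((norm a)\<^sup>2)"
      unfolding cip_self[symmetric] by (simp add: cip_linear)
    also have "\<dots> = of_real ((norm k)\<^sup>2 * (norm a)\<^sup>2)"
      by (simp add: complex_norm_square[symmetric])
    finally show ?thesis by (simp only: of_real_eq_iff)
  qed
  have "continuous_on {0..} (\<lambda>x. k *s f x)"
    using assms unfolding vector_scalar_mult_def square_integrable_def by (intro continuous_intros) auto
  moreover have "(\<lambda>x. (norm (k *s f x))\<^sup>2) integrable_on {0..}"
    unfolding n using assms by (intro integrable_on_mult_right) (simp add: square_integrable_def)
  ultimately show ?thesis by (simp add: square_integrable_def)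
qed

lemma square_integrable_add:
  assumes "square_integrable f" "square_integrable g"
  shows "square_integrable (\<lambda>x. f x + g x)"
proof -
  have n: "(norm (f x + g x))\<^sup>2 = Re (cip (f x) (f x) + cip (f x) (g x) + (cip (g x) (f x) + cip (g x) (g x)))" for x
  proof -
    have "complex_of_real ((norm (f x + g x))\<^sup>2) = cip (f x + g x) (f x + g x)" by (simp only: cip_self)
    then show ?thesis by (simp add: cip_linear complex_eq_iff)
  qed
  have "(\<lambda>x. cip (f x) (f x) + cip (f x) (g x) + (cip (g x) (f x) + cip (g x) (g x))) integrable_on {0..}"
    using assms by (intro integrable_add integrable_cip)
  from has_integral_Re[OF integrable_integral[OF this]]
  have "(\<lambda>x. (norm (f x + g x))\<^sup>2) integrable_on {0..}"
    unfolding n by (rule has_integral_integrable)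
  then show ?thesis using assms by (simp add: square_integrable_def continuous_on_add)
qed

lemma square_integrable_diff:
  assumes "square_integrable f" "square_integrable g"
  shows "square_integrable (\<lambda>x. f x - g x)"
  using square_integrable_add[OF assms(1) square_integrable_scale[OF assms(2), of "-1"]] by simp

lemmas square_integrable_intros = square_integrable_scale square_integrable_add square_integrable_diff

lemma ip_add_left: "square_integrable f \<Longrightarrow> square_integrable g \<Longrightarrow> square_integrable h \<Longrightarrow>
    ip (\<lambda>x. f x + g x) h = ip f h + ip g h"
  and ip_diff_left: "square_integrable f \<Longrightarrow> square_integrable g \<Longrightarrow> square_integrable h \<Longrightarrow>
    ip (\<lambda>x. f x - g x) h = ip f h - ip g h"
  and ip_add_right: "square_integrable f \<Longrightarrow> square_integrable g \<Longrightarrow> square_integrable h \<Longrightarrow>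
    ip h (\<lambda>x. f x + g x) = ip h f + ip h g"
  and ip_diff_right: "square_integrable f \<Longrightarrow> square_integrable g \<Longrightarrow> square_integrable h \<Longrightarrow>
    ip h (\<lambda>x. f x - g x) = ip h f - ip h g"
  unfolding ip_def cip_linear 
  by (rule Henstock_Kurzweil_Integration.integral_add Henstock_Kurzweil_Integration.integral_diff;
      rule integrable_cip; assumption)+

lemma ip_scale_left: "ip (\<lambda>x. k *s f x) h = k * ip f h"
  and ip_scale_right: "ip h (\<lambda>x. k *s f x) = cnj k * ip h f"
  by (simp_all add: ip_def cip_linear)

lemmas ip_linear = ip_add_left ip_diff_left ip_add_right ip_diff_right ip_scale_left ip_scale_right

lemma ip_commute: "ip g f = cnj (ip f g)"
  unfolding ip_def cip_commute[of "g _"] by (rule Henstock_Kurzweil_Integration.integral_cnj[symmetric])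

lemma ip_self: "square_integrable f \<Longrightarrow> ip f f = of_real (norm_sq f)"
  unfolding ip_def norm_sq_def cip_self square_integrable_def
  by (intro integral_unique has_integral_of_real integrable_integral) simp

lemma norm_sq_nonneg: "norm_sq f \<ge> 0"
  unfolding norm_sq_def
  by (cases "(\<lambda>x. (norm (f x))\<^sup>2) integrable_on {0..}") (auto simp: Henstock_Kurzweil_Integration.integral_nonneg not_integrable_integral)

lemma norm_ip_le:
  assumes "square_integrable f" "square_integrable g" "\<kappa> > 0"
  shows "norm (ip f g) \<le> (\<kappa> * norm_sq f + norm_sq g / \<kappa>) / 2"
proof -
  have int: "(\<lambda>x. (norm (f x))\<^sup>2) integrable_on {0..}" "(\<lambda>x. (norm (g x))\<^sup>2) integrable_on {0..}"
    using assms by (auto simp: square_integrable_def)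
  have "norm (ip f g) \<le> integral {0..} (\<lambda>x. (\<kappa> * (norm (f x))\<^sup>2 + (norm (g x))\<^sup>2 / \<kappa>) / 2)"
    unfolding ip_def
  proof (rule integral_norm_bound_integral)
    show "(\<lambda>x. (\<kappa> * (norm (f x))\<^sup>2 + (norm (g x))\<^sup>2 / \<kappa>) / 2) integrable_on {0..}"
      using int by (intro integrable_on_divide integrable_add integrable_on_mult_right)
  qed (use assms norm_cip_le integrable_cip in auto)
  also have "\<dots> = (\<kappa> * norm_sq f + norm_sq g / \<kappa>) / 2"
    using int by (simp add: norm_sq_def Henstock_Kurzweil_Integration.integral_add integrable_on_divide integrable_on_mult_right)
  finally show ?thesis .
qed

text \<open>If d = (A - z)^(-1) h for a symmetric operator A, then z d + h = A d, and symmetry is the hypothesis of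
  the lemma; the conclusion is the usual resolvent bound.\<close>

lemma resolvent_bound:
  assumes d: "square_integrable d" and h: "square_integrable h" and z: "Im z > 0"
    and sym: "ip (\<lambda>x. z *s d x + h x) d = ip d (\<lambda>x. z *s d x + h x)"
  shows "norm_sq d \<le> norm_sq h / (Im z)\<^sup>2"
proof -
  have "z * ip d d + ip h d = cnj z * ip d d + ip d h"
    using sym d h by (simp add: ip_linear square_integrable_intros)
  then have "Im (z * ip d d + ip h d) = Im (cnj z * ip d d + ip d h)" by simp
  then have "Im z * norm_sq d = - Im (ip h d)"
    unfolding ip_self[OF d] ip_commute[of d h] by simp
  also have "\<dots> \<le> norm (ip h d)" using abs_Im_le_cmod[of "ip h d"] by linarith
  also have "\<dots> \<le> (1 / Im z * norm_sq h + norm_sq d / (1 / Im z)) / 2"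
    by (rule norm_ip_le[OF h d]) (use z in simp)
  finally have "Im z * norm_sq d \<le> norm_sq h / Im z" by (simp add: field_simps)
  then show ?thesis using z by (simp add: field_simps power2_eq_square)
qed

lemma nevanlinna_kernel_imp_Im_nonneg:
  assumes si: "square_integrable (y z)" and z: "Im z > 0"
    and ker: "(z - cnj z) * ip (y z) (y z) = f z - cnj (f z)"
  shows "Im (f z) \<ge> 0"
proof -
  have "Im ((z - cnj z) * ip (y z) (y z)) = 2 * Im (f z)" unfolding ker by simp
  then have "Im (f z) = Im z * norm_sq (y z)" unfolding ip_self[OF si] by simp
  then show ?thesis using z norm_sq_nonneg[of "y z"] by simp
qed

text \<open>The kernel identity says that the relation spanned by the pairs (y_z - y_w, z y_z - w y_w) is symmetric. Thus
  r_z = (y_z - y_w) / (z - w) plays the role of (A - z)^(-1) y_w for a symmetric A, and r_z - r_z' that of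
  (A - z)^(-1) applied to (z - z') r_z'. The resolvent bound, used twice, shows that r_z depends on z in a
  Lipschitz way near w. By the kernel identity the difference quotient of f at w equals
  <y_w, y_w> + (z - cnj w) <r_z, y_w>, which therefore converges.\<close>

lemma nevanlinna_kernel_imp_holomorphic:
  fixes y :: "complex \<Rightarrow> real \<Rightarrow> complex^'n"
  assumes si: "\<And>z. Im z > 0 \<Longrightarrow> square_integrable (y z)"
    and ker: "\<And>z w. Im z > 0 \<Longrightarrow> Im w > 0 \<Longrightarrow> (z - cnj w) * ip (y z) (y w) = f z - cnj (f w)"
  shows "f holomorphic_on {z. Im z > 0}"
proof -
  have "f field_differentiable at w" if w: "Im w > 0" for w
  proof -
    define r where "r = (\<lambda>z x. (1 / (z - w)) *s (y z x - y w x))"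
    define b where "b = (\<lambda>z x. z *s r z x + y w x)"
    have si_r: "square_integrable (r z)" if "Im z > 0" for z
      unfolding r_def using si[OF that] si[OF w] by (intro square_integrable_intros)
    have b_eq: "b z = (\<lambda>x. (1 / (z - w)) *s (z *s y z x - w *s y w x))" if "z \<noteq> w" for z
    proof -
      have "z * (1 / (z - w) * (p - q)) + q = 1 / (z - w) * (z * p - w * q)" for p q
        using that by (simp add: divide_simps) (simp add: algebra_simps)
      then show ?thesis
        by (simp only: b_def r_def fun_eq_iff vec_eq_iff vector_add_component vector_smult_component
            vector_minus_component simp_thms)
    qed
    have sym: "ip (b z) (r z') = ip (r z) (b z')"
      if "Im z > 0" "Im z' > 0" "z \<noteq> w" "z' \<noteq> w" for z z'
    proof -
      note s = si[OF that(1)] si[OF that(2)] si[OF w]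
      have "z * ip (y z) (y z') - w * ip (y w) (y z') - (z * ip (y z) (y w) - w * ip (y w) (y w))
          = cnj z' * ip (y z) (y z') - cnj z' * ip (y w) (y z') - (cnj w * ip (y z) (y w) - cnj w * ip (y w) (y w))"
        using ker[OF that(1,2)] ker[OF that(1) w] ker[OF w that(2)] ker[OF w w]
        by (simp add: algebra_simps) algebra
      then have "ip (\<lambda>x. z *s y z x - w *s y w x) (\<lambda>x. y z' x - y w x)
          = ip (\<lambda>x. y z x - y w x) (\<lambda>x. z' *s y z' x - w *s y w x)"
        using s by (simp add: ip_linear square_integrable_intros algebra_simps)
      then show ?thesis
        unfolding b_eq[OF that(3)] b_eq[OF that(4)] unfolding r_def by (simp only: ip_scale_left ip_scale_right)
    qed
    define \<eta> where "\<eta> = Im w / 2"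
    have \<eta>: "\<eta> > 0" using w by (simp add: \<eta>_def)
    define X where "X = ball w \<eta> - {w}"
    have X: "Im z > \<eta>" "Im z > 0" "z \<noteq> w" if "z \<in> X" for z
    proof -
      have "norm (w - z) < \<eta>" "z \<noteq> w" using that by (auto simp: X_def dist_norm)
      then show "Im z > \<eta>" "Im z > 0" "z \<noteq> w"
        using abs_Im_le_cmod[of "w - z"] \<eta> by (auto simp: \<eta>_def)
    qed
    define A where "A = norm_sq (y w) / \<eta>\<^sup>2"
    have r_bound: "norm_sq (r z) \<le> A" if z: "z \<in> X" for z
    proof -
      have "norm_sq (r z) \<le> norm_sq (y w) / (Im z)\<^sup>2"
        by (rule resolvent_bound[OF si_r[OF X(2)[OF z]] si[OF w] X(2)[OF z]])
           (use sym[of z z] X[OF z] in \<open>simp add: b_def\<close>)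
      also have "\<dots> \<le> A"
        unfolding A_def using X[OF z] \<eta> norm_sq_nonneg by (intro divide_left_mono power_mono) auto
      finally show ?thesis .
    qed
    define m where "m = (\<lambda>z. ip (r z) (y w))"
    define C where "C = (A / \<eta>\<^sup>2 + norm_sq (y w)) / 2"
    have lip: "norm (m z - m z') \<le> C * norm (z - z')" if z: "z \<in> X" and z': "z' \<in> X" for z z'
    proof (cases "z = z'")
      case True
      then show ?thesis by simp
    next
      case False
      note s = si_r[OF X(2)[OF z]] si_r[OF X(2)[OF z']] si[OF w]
      define d where "d = (\<lambda>x. r z x - r z' x)"
      define h where "h = (\<lambda>x. (z - z') *s r z' x)"
      have si_d: "square_integrable d" and si_h: "square_integrable h"
        unfolding d_def h_def using s by (auto intro: square_integrable_intros)
      have si_b: "square_integrable (b z)" "square_integrable (b z')"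
        unfolding b_def using s by (auto intro: square_integrable_intros)
      have e: "(\<lambda>x. z *s d x + h x) = (\<lambda>x. b z x - b z' x)"
        by (simp add: d_def h_def b_def fun_eq_iff vec_eq_iff algebra_simps)
      have "norm_sq d \<le> norm_sq h / (Im z)\<^sup>2"
      proof (rule resolvent_bound[OF si_d si_h X(2)[OF z]])
        show "ip (\<lambda>x. z *s d x + h x) d = ip d (\<lambda>x. z *s d x + h x)"
          unfolding e unfolding d_def using s si_b sym X[OF z] X[OF z']
          by (simp add: ip_linear square_integrable_intros)
      qed
      also have "norm_sq h = (norm (z - z'))\<^sup>2 * norm_sq (r z')"
      proof -
        have "complex_of_real (norm_sq h) = (z - z') * cnj (z - z') * of_real (norm_sq (r z'))"
          unfolding ip_self[OF si_h, symmetric] ip_self[OF s(2), symmetric]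
          unfolding h_def ip_scale_left ip_scale_right by (simp only: mult.assoc)
        also have "\<dots> = of_real ((norm (z - z'))\<^sup>2 * norm_sq (r z'))"
          by (simp only: complex_norm_square of_real_mult)
        finally show ?thesis by (simp only: of_real_eq_iff)
      qed
      also have "(norm (z - z'))\<^sup>2 * norm_sq (r z') / (Im z)\<^sup>2 \<le> (norm (z - z'))\<^sup>2 * A / \<eta>\<^sup>2"
        using r_bound[OF z'] X[OF z] \<eta> norm_sq_nonneg order_trans[OF norm_sq_nonneg r_bound[OF z']]
        by (intro frac_le mult_mono power_mono mult_nonneg_nonneg) auto
      finally have d_le: "norm_sq d \<le> (norm (z - z'))\<^sup>2 * A / \<eta>\<^sup>2" .
      \<comment> \<open>The weight 1 / norm (z - z') balances the quadratic bound for d against the fixed vector y w.\<close>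
      have "m z - m z' = ip d (y w)" using s by (simp add: m_def d_def ip_linear)
      also have "norm \<dots> \<le> (1 / norm (z - z') * norm_sq d + norm_sq (y w) / (1 / norm (z - z'))) / 2"
        by (rule norm_ip_le[OF si_d si[OF w]]) (use False in simp)
      also have "\<dots> \<le> (1 / norm (z - z') * ((norm (z - z'))\<^sup>2 * A / \<eta>\<^sup>2) + norm_sq (y w) / (1 / norm (z - z'))) / 2"
        using d_le by (intro divide_right_mono add_right_mono mult_left_mono) auto
      also have "\<dots> = C * norm (z - z')"
        using False by (simp add: C_def field_simps power2_eq_square)
      finally show ?thesis .
    qed
    have "uniformly_continuous_on X m"
      unfolding uniformly_continuous_on_def
    proof (intro allI impI)
      fix e :: real assume e: "e > 0"
      have C: "C \<ge> 0" using norm_sq_nonneg[of "y w"] by (simp add: C_def A_def)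
      show "\<exists>d>0. \<forall>x\<in>X. \<forall>x'\<in>X. dist x' x < d \<longrightarrow> dist (m x') (m x) < e"
      proof (intro exI[of _ "e / (C + 1)"] conjI ballI impI)
        fix x x' assume x: "x \<in> X" "x' \<in> X" "dist x' x < e / (C + 1)"
        have "dist (m x') (m x) \<le> C * dist x' x" using lip[OF x(2,1)] by (simp add: dist_norm)
        also have "\<dots> \<le> (C + 1) * dist x' x" by (intro mult_right_mono) auto
        also have "\<dots> < e" using x(3) C by (simp add: field_simps)
        finally show "dist (m x') (m x) < e" .
      qed (use e C in auto)
    qed
    moreover have "w \<in> closure X"
    proof -
      have "w islimpt ball w \<eta>" using \<eta> by (intro interior_limit_point) auto
      then show ?thesis unfolding X_def by (simp add: closure_def islimpt_punctured[symmetric])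
    qed
    ultimately obtain l where "(m \<longlongrightarrow> l) (at w within X)"
      by (rule uniformly_continuous_on_extension_at_closure)
    moreover have "at w within X = at w"
      by (rule at_within_nhd[of w "ball w \<eta>"]) (use \<eta> in \<open>auto simp: X_def\<close>)
    ultimately have m_lim: "(m \<longlongrightarrow> l) (at w)" by simp
    have "((\<lambda>z. ip (y w) (y w) + (z - cnj w) * m z) \<longlongrightarrow> ip (y w) (y w) + (w - cnj w) * l) (at w)"
      by (intro tendsto_intros m_lim)
    moreover have "\<forall>\<^sub>F z in at w. ip (y w) (y w) + (z - cnj w) * m z = (f z - f w) / (z - w)"
      unfolding eventually_at
    proof (intro exI[of _ \<eta>] conjI ballI impI)
      fix z assume z: "z \<noteq> w \<and> dist z w < \<eta>"
      then have zX: "z \<in> X" by (simp add: X_def dist_commute)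
      have "m z * (z - w) = ip (y z) (y w) - ip (y w) (y w)"
        unfolding m_def r_def ip_scale_left ip_diff_left[OF si[OF X(2)[OF zX]] si[OF w] si[OF w]]
        using z by simp
      then show "ip (y w) (y w) + (z - cnj w) * m z = (f z - f w) / (z - w)"
        using ker[OF X(2)[OF zX] w] ker[OF w w] z
        by (simp add: eq_divide_eq) algebra
    qed (use \<eta> in auto)
    ultimately have "((\<lambda>z. (f z - f w) / (z - w)) \<longlongrightarrow> ip (y w) (y w) + (w - cnj w) * l) (at w)"
      by (rule Lim_transform_eventually)
    then show ?thesis
      unfolding field_differentiable_def has_field_derivative_iff by blast
  qed
  then show ?thesis
    by (intro holomorphic_on_open[THEN iffD2] ballI) 
       (auto simp: open_halfspace_Im_gt field_differentiable_def)
qed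

section \<open>The Weyl function\<close>

lemma dirac_solution_continuous_on:
  assumes "dirac_solution v z U"
  shows "continuous_on {0..} U"
  unfolding continuous_on_eq_continuous_within
proof
  fix x :: real assume x: "x \<in> {0..}"
  then have "absolutely_continuous_on_interval 0 (x + 1) U"
    using assms by (simp add: dirac_solution_def)
  then have "continuous_on {0..x + 1} U"
    by (rule absolutely_continuous_imp_continuous_on)
  then have "continuous (at x within {0..x + 1}) U"
    using x by (simp add: continuous_on_eq_continuous_within)
  moreover have "at x within {0..x + 1} = at x within {0..}"
    by (rule at_within_nhd[of x "{..<x + 1}"]) auto
  ultimately show "continuous (at x within {0..}) U" by (simp add: continuous_within)
qed

text \<open>The squared norm of the solution is the quadratic form of the integrable matrix function at \<xi>.\<close>

lemma weyl_solution_square_integrable: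
  fixes P :: "complex^'p^'p"
  assumes sol: "dirac_solution v z U"
    and int: "(\<lambda>x. block_row (mat 1) (\<i> *\<^sub>C conj_transpose P) ** conj_transpose (U x) ** U x
      ** block_col (mat 1) (- (\<i> *\<^sub>C P))) absolutely_integrable_on {0..}"
  shows "square_integrable (\<lambda>x. U x *v (block_col (mat 1) (- (\<i> *\<^sub>C P)) *v \<xi>))"
proof -
  define B where "B = block_col (mat 1) (- (\<i> *\<^sub>C P))"
  define M where "M = (\<lambda>x. conj_transpose B ** conj_transpose (U x) ** U x ** B)"
  have M: "M absolutely_integrable_on {0..}"
    using int unfolding M_def B_def conj_transpose_weyl_column .
  have cont: "continuous_on {0..} (\<lambda>x. U x *v (B *v \<xi>))"
    unfolding matrix_vector_mult_def using dirac_solution_continuous_on[OF sol]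
    by (intro continuous_intros)
  have norm: "Re (cip (M x *v \<xi>) \<xi>) = (norm (U x *v (B *v \<xi>)))\<^sup>2" for x
  proof -
    have "cip (M x *v \<xi>) \<xi> = cip (U x *v (B *v \<xi>)) (U x *v (B *v \<xi>))"
      by (simp add: M_def cip_adjoint[of "conj_transpose _"] flip: matrix_vector_mul_assoc)
    then show ?thesis by (simp add: cip_self)
  qed
  have "bounded_linear (\<lambda>A :: complex^'p^'p. Re (cip (A *v \<xi>) \<xi>))"
    by (subst linear_conv_bounded_linear[symmetric])
       (auto intro!: linearI simp: cip_linear matrix_vector_mult_add_rdistrib scaleR_mult_vec)
  from absolutely_integrable_linear[OF M this]
  have "(\<lambda>x. (norm (U x *v (B *v \<xi>)))\<^sup>2) integrable_on {0..}"
    using set_lebesgue_integral_eq_integral(1) by (simp add: o_def norm)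
  then show ?thesis using cont by (simp add: square_integrable_def B_def)
qed

lemma dirac_current_has_integral:
  fixes U1 U2 :: "real \<Rightarrow> complex^('p::finite + 'p)^('p + 'p)" and a b :: "complex^('p + 'p)"
  assumes sol1: "dirac_solution v z U1" and sol2: "dirac_solution v w U2" and l: "l > 0"
  shows "((\<lambda>x. \<i> * (z - cnj w) * cip (U1 x *v a) (U2 x *v b)) has_integral
    cip (dirac_j *v (U1 l *v a)) (U2 l *v b) - cip (dirac_j *v (U1 0 *v a)) (U2 0 *v b)) {0..l}"
proof -
  interpret bounded_bilinear "\<lambda>P Q. cip (dirac_j *v ((P :: complex^('p + 'p)^('p + 'p)) *v a)) ((Q :: complex^('p + 'p)^('p + 'p)) *v b)"
    by (rule bounded_bilinear_cip_matrix)
  define R where "R = (\<lambda>\<zeta> (U :: real \<Rightarrow> complex^('p + 'p)^('p + 'p)) x.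
    \<i> *\<^sub>C ((\<zeta> *\<^sub>C dirac_j + dirac_j ** dirac_V (v x)) ** U x))"
  have R_mult: "R \<zeta> U x *v c = \<i> *s (\<zeta> *s (dirac_j *v (U x *v c)) + dirac_j *v (dirac_V (v x) *v (U x *v c)))" for \<zeta> U x c
    by (simp add: R_def cscale_mult_vec matrix_vector_mult_add_rdistrib flip: matrix_vector_mul_assoc)
  have "AE x in lebesgue. (x > 0 \<longrightarrow> (U1 has_vector_derivative R z U1 x) (at x))
      \<and> (x > 0 \<longrightarrow> (U2 has_vector_derivative R w U2 x) (at x))"
    using sol1 sol2 unfolding dirac_solution_def R_def by (intro AE_conjI) auto
  then obtain N where N: "N \<in> null_sets lebesgue"
     "{x \<in> space lebesgue. \<not> ((x > 0 \<longrightarrow> (U1 has_vector_derivative R z U1 x) (at x))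
      \<and> (x > 0 \<longrightarrow> (U2 has_vector_derivative R w U2 x) (at x)))} \<subseteq> N"
    unfolding eventually_ae_filter by blast
  show ?thesis
  proof (rule absolutely_continuous_has_integral[where N = N])
    show "absolutely_continuous_on_interval 0 l (\<lambda>x. cip (dirac_j *v (U1 x *v a)) (U2 x *v b))"
      by (rule absolutely_continuous_on_interval) (use sol1 sol2 l in \<open>auto simp: dirac_solution_def\<close>)
    show "negligible N" using N(1) by (simp add: negligible_iff_null_sets)
    fix x assume x: "x \<in> {0<..<l} - N"
    then have d1: "(U1 has_derivative (\<lambda>h. h *\<^sub>R R z U1 x)) (at x)"
      and d2: "(U2 has_derivative (\<lambda>h. h *\<^sub>R R w U2 x)) (at x)"
      using N(2) by (auto simp: has_vector_derivative_def)
    have "cip (dirac_j *v (U1 x *v a)) (R w U2 x *v b) + cip (dirac_j *v (R z U1 x *v a)) (U2 x *v b)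
        = \<i> * (z - cnj w) * cip (U1 x *v a) (U2 x *v b)"
      unfolding R_mult using dirac_current_derivative[where z = z and \<zeta> = w and w = "v x" and a = "U1 x *v a" and b = "U2 x *v b"]
      by (simp only: add.commute)
    then have "h *\<^sub>R (\<i> * (z - cnj w) * cip (U1 x *v a) (U2 x *v b))
       = cip (dirac_j *v (U1 x *v a)) ((h *\<^sub>R R w U2 x) *v b)
         + cip (dirac_j *v ((h *\<^sub>R R z U1 x) *v a)) (U2 x *v b)" for h :: real
      by (simp add: scaleR_left scaleR_right flip: scaleR_add_right)
    then show "((\<lambda>x. cip (dirac_j *v (U1 x *v a)) (U2 x *v b)) has_vector_derivative
        \<i> * (z - cnj w) * cip (U1 x *v a) (U2 x *v b)) (at x)"
      unfolding has_vector_derivative_def using FDERIV[OF d1 d2] by simp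
  qed (use l in auto)
qed

text \<open>The current y_w^* j y_z has an integrable derivative, hence a limit at infinity. The current is also bounded by
  an integrable function, so the limit is 0 and the integral of the derivative is minus the initial value.\<close>

lemma dirac_kernel_identity:
  fixes U1 U2 :: "real \<Rightarrow> complex^('p::finite + 'p)^('p + 'p)" and a b :: "complex^('p + 'p)"
  assumes sol1: "dirac_solution v z U1" and sol2: "dirac_solution v w U2"
    and si1: "square_integrable (\<lambda>x. U1 x *v a)" and si2: "square_integrable (\<lambda>x. U2 x *v b)"
  shows "\<i> * (z - cnj w) * ip (\<lambda>x. U1 x *v a) (\<lambda>x. U2 x *v b) = - cip (dirac_j *v (U1 0 *v a)) (U2 0 *v b)"
proof -
  define G where "G = (\<lambda>x. cip (dirac_j *v (U1 x *v a)) (U2 x *v b))"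
  define k where "k = \<i> * (z - cnj w)"
  have "((\<lambda>l. k * integral {0..l} (\<lambda>x. cip (U1 x *v a) (U2 x *v b)) + G 0)
      \<longlongrightarrow> k * ip (\<lambda>x. U1 x *v a) (\<lambda>x. U2 x *v b) + G 0) at_top"
    unfolding ip_def by (intro tendsto_intros integral_tendsto_at_top absolutely_integrable_cip si1 si2)
  moreover have "\<forall>\<^sub>F l in at_top. k * integral {0..l} (\<lambda>x. cip (U1 x *v a) (U2 x *v b)) + G 0 = G l"
    using eventually_gt_at_top[of 0]
  proof eventually_elim
    case (elim l)
    from integral_unique[OF dirac_current_has_integral[OF sol1 sol2 elim, of a b]]
    have "k * integral {0..l} (\<lambda>x. cip (U1 x *v a) (U2 x *v b)) = G l - G 0"
      by (simp add: k_def G_def)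
    then show ?case by simp
  qed
  ultimately have lim: "(G \<longlongrightarrow> k * ip (\<lambda>x. U1 x *v a) (\<lambda>x. U2 x *v b) + G 0) at_top"
    by (rule Lim_transform_eventually)
  have norm_j: "norm (dirac_j *v c) = norm c" for c :: "complex^('p + 'p)"
  proof -
    have "complex_of_real ((norm (dirac_j *v c))\<^sup>2) = of_real ((norm c)\<^sup>2)"
      unfolding cip_self[symmetric] by (simp add: cip_dirac_j dirac_j_involution)
    then show ?thesis by (simp only: of_real_eq_iff) simp
  qed
  have "k * ip (\<lambda>x. U1 x *v a) (\<lambda>x. U2 x *v b) + G 0 = 0"
  proof (rule limit_zero_of_integrable_bound[OF lim])
    show "norm (G x) \<le> ((norm (U1 x *v a))\<^sup>2 + (norm (U2 x *v b))\<^sup>2) / 2" for x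
      using norm_cip_le[of 1 "dirac_j *v (U1 x *v a)" "U2 x *v b"] by (simp add: G_def norm_j)
    show "(\<lambda>x. ((norm (U1 x *v a))\<^sup>2 + (norm (U2 x *v b))\<^sup>2) / 2) absolutely_integrable_on {0..}"
      by (intro nonnegative_absolutely_integrable_1 integrable_on_divide integrable_add)
         (use si1 si2 in \<open>auto simp: square_integrable_def\<close>)
  qed
  then show ?thesis by (simp add: k_def G_def add_eq_0_iff)
qed

lemma weyl_function_quadratic_form_nevanlinna:
  fixes \<phi> :: "complex \<Rightarrow> complex^'p^'p" and \<xi> :: "complex^'p"
  assumes "weyl_function v \<phi>"
  defines "f \<equiv> \<lambda>\<zeta>. cip (\<phi> \<zeta> *v \<xi>) \<xi>"
  shows "f holomorphic_on {\<zeta>. Im \<zeta> > 0}" and "\<And>\<zeta>. Im \<zeta> > 0 \<Longrightarrow> Im (f \<zeta>) \<ge> 0"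
proof -
  obtain u where u: "normalized_fundamental_solution v u"
    and int: "\<And>\<zeta>. Im \<zeta> > 0 \<Longrightarrow>
      (\<lambda>x. block_row (mat 1) (\<i> *\<^sub>C conj_transpose (\<phi> \<zeta>)) ** conj_transpose (u x \<zeta>) ** u x \<zeta>
              ** block_col (mat 1) (- (\<i> *\<^sub>C \<phi> \<zeta>))) absolutely_integrable_on {0..}"
    using assms unfolding weyl_function_def by blast
  define y where "y = (\<lambda>\<zeta> x. u x \<zeta> *v (block_col (mat 1) (- (\<i> *\<^sub>C \<phi> \<zeta>)) *v \<xi>))"
  have sol: "dirac_solution v \<zeta> (\<lambda>x. u x \<zeta>)"
    and init: "u 0 \<zeta> = (1 / sqrt 2) *\<^sub>R block_mat (mat 1) (mat 1) (- mat 1) (mat 1)" for \<zeta>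
    using u by (auto simp: normalized_fundamental_solution_def)
  have si: "square_integrable (y \<zeta>)" if "Im \<zeta> > 0" for \<zeta>
    unfolding y_def by (rule weyl_solution_square_integrable[OF sol int[OF that]])
  have ker: "(\<zeta> - cnj w) * ip (y \<zeta>) (y w) = f \<zeta> - cnj (f w)" if "Im \<zeta> > 0" "Im w > 0" for \<zeta> w
  proof -
    have "\<i> * (\<zeta> - cnj w) * ip (y \<zeta>) (y w) = - cip (dirac_j *v y \<zeta> 0) (y w 0)"
      unfolding y_def using si[OF that(1)] si[OF that(2)] unfolding y_def
      by (rule dirac_kernel_identity[OF sol sol])
    also have "\<dots> = \<i> * (f \<zeta> - cnj (f w))"
      unfolding y_def init dirac_initial_current f_def by simp
    finally show ?thesis by (simp add: mult.assoc)
  qed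
  show "f holomorphic_on {\<zeta>. Im \<zeta> > 0}"
    by (rule nevanlinna_kernel_imp_holomorphic[of y, OF si ker])
  show "Im (f \<zeta>) \<ge> 0" if "Im \<zeta> > 0" for \<zeta>
    by (rule nevanlinna_kernel_imp_Im_nonneg[of y \<zeta> f, OF si[OF that] that ker[OF that that]])
qed

lemma sampling_error_nevanlinna_bigo:
  assumes eps: "\<epsilon> > 0" and z: "Im z > 1/2 + \<epsilon>"
    and hol: "f holomorphic_on {\<zeta>. Im \<zeta> > 0}" and pos: "\<And>\<zeta>. Im \<zeta> > 0 \<Longrightarrow> Im (f \<zeta>) \<ge> 0"
  shows "(\<lambda>N. norm (sampling_error \<epsilon> z N (\<lambda>\<zeta>. f \<zeta> / \<zeta>\<^sup>2))) \<in> O(\<lambda>N. real N powr (1/2 + \<epsilon> - Im z))"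
proof -
  obtain C N0 where "C \<ge> 0"
    and C1: "\<And>N. N \<ge> N0 \<Longrightarrow> norm (sampling_error \<epsilon> z N (\<lambda>\<zeta>. 1 / \<zeta>\<^sup>2)) \<le> C * real N powr (1/2 + \<epsilon> - Im z)"
    and C2: "\<And>N t. N \<ge> N0 \<Longrightarrow> t \<noteq> 0 \<Longrightarrow>
      norm (sampling_error \<epsilon> z N (\<lambda>\<zeta>. (1 + complex_of_real t * \<zeta>) / (of_real t - \<zeta>) / \<zeta>\<^sup>2))
        \<le> C * real N powr (1/2 + \<epsilon> - Im z)"
    by (rule sampling_error_kernels_decay[OF eps z]) blast
  have "norm (sampling_error \<epsilon> z N (\<lambda>\<zeta>. f \<zeta> / \<zeta>\<^sup>2)) \<le> 3 * norm (f \<i>) * (C * real N powr (1/2 + \<epsilon> - Im z))"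
    if "N \<ge> N0" for N
    by (rule norm_sampling_error_nevanlinna_le[OF eps _ C1[OF that] C2[OF that] hol pos]) (use z in auto)
  then show ?thesis
    by (intro bigoI[of _ "3 * norm (f \<i>) * C"]) (auto intro!: eventually_sequentiallyI[of N0] simp: mult.assoc)
qed

lemma matrix_entry_polarization:
  fixes P :: "complex^'p^'p"
  defines "Q \<equiv> \<lambda>\<xi>. cip (P *v \<xi>) \<xi>"
  shows "P $ b $ a = 1/4 * Q (axis a 1 + axis b 1) + ((-1/4) * Q (axis a 1 - axis b 1)
    + (\<i>/4 * Q (axis a 1 + \<i> *s axis b 1) + (-\<i>/4) * Q (axis a 1 - \<i> *s axis b 1)))"
proof -
  have "cip x (axis b 1) = x $ b" for x :: "complex^'p"
    by (simp add: cip_def axis_def if_distrib cong: if_cong)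
  then have "P $ b $ a = cip (P *v axis a 1) (axis b 1)"
    by (simp add: matrix_vector_mult_def axis_def if_distrib cong: if_cong)
  then show ?thesis
    unfolding Q_def
    by (simp add: cip_linear matrix_vector_right_distrib matrix_vector_mult_diff_distrib vector_scalar_commute
        algebra_simps)
qed

lemma sampling_error_weyl_entry_bigo:
  fixes \<phi> :: "complex \<Rightarrow> complex^'p^'p"
  assumes weyl: "weyl_function v \<phi>" and eps: "\<epsilon> > 0" and z: "Im z > 1/2 + \<epsilon>"
  shows "(\<lambda>N. norm (sampling_error \<epsilon> z N (\<lambda>\<zeta>. \<phi> \<zeta> $ b $ a / \<zeta>\<^sup>2))) \<in> O(\<lambda>N. real N powr (1/2 + \<epsilon> - Im z))"
proof -
  define f where "f = (\<lambda>\<xi> \<zeta>. cip (\<phi> \<zeta> *v \<xi>) \<xi>)"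
  define T where "T = (\<lambda>\<xi> N. sampling_error \<epsilon> z N (\<lambda>\<zeta>. f \<xi> \<zeta> / \<zeta>\<^sup>2))"
  have T: "(\<lambda>N. norm (T \<xi> N)) \<in> O(\<lambda>N. real N powr (1/2 + \<epsilon> - Im z))" for \<xi>
    unfolding T_def f_def
    by (rule sampling_error_nevanlinna_bigo[OF eps z weyl_function_quadratic_form_nevanlinna[OF weyl]])
  define x1 x2 x3 x4 :: "complex^'p" where "x1 = axis a 1 + axis b 1" and "x2 = axis a 1 - axis b 1"
    and "x3 = axis a 1 + \<i> *s axis b 1" and "x4 = axis a 1 - \<i> *s axis b 1"
  have "sampling_error \<epsilon> z N (\<lambda>\<zeta>. \<phi> \<zeta> $ b $ a / \<zeta>\<^sup>2)
     = 1/4 * T x1 N + ((-1/4) * T x2 N + (\<i>/4 * T x3 N + (-\<i>/4) * T x4 N))" for N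
  proof -
    have "sampling_error \<epsilon> z N (\<lambda>\<zeta>. \<phi> \<zeta> $ b $ a / \<zeta>\<^sup>2)
      = sampling_error \<epsilon> z N (\<lambda>\<zeta>. 1/4 * (f x1 \<zeta> / \<zeta>\<^sup>2) + ((-1/4) * (f x2 \<zeta> / \<zeta>\<^sup>2)
          + (\<i>/4 * (f x3 \<zeta> / \<zeta>\<^sup>2) + (-\<i>/4) * (f x4 \<zeta> / \<zeta>\<^sup>2))))"
      unfolding matrix_entry_polarization[of "\<phi> _" b a] f_def x1_def x2_def x3_def x4_def
      by (simp only: add_divide_distrib times_divide_eq_right)
    then show ?thesis unfolding sampling_error_add sampling_error_cmult T_def .
  qed
  note decomposition = this
  have le: "norm (sampling_error \<epsilon> z N (\<lambda>\<zeta>. \<phi> \<zeta> $ b $ a / \<zeta>\<^sup>2))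
     \<le> norm (T x1 N) + (norm (T x2 N) + (norm (T x3 N) + norm (T x4 N)))" for N
    unfolding decomposition by (intro norm_triangle_le add_mono) (simp_all add: norm_mult norm_divide)
  have "(\<lambda>N. norm (T x1 N) + (norm (T x2 N) + (norm (T x3 N) + norm (T x4 N))))
      \<in> O(\<lambda>N. real N powr (1/2 + \<epsilon> - Im z))"
    by (intro sum_in_bigo T)
  then show ?thesis
    by (rule landau_o.big_trans[rotated]) (use le in \<open>auto intro!: bigoI[of _ 1]\<close>)
qed

lemma cscale_nth: "(k *\<^sub>C A) $ i $ j = k * A $ i $ j"
  by (simp add: cscale_def map_matrix_def)

text \<open>The sign in the representation comes from (i (q + \<epsilon>))^2 = - (q + \<epsilon>)^2.\<close>

lemma weyl_partial_sum_error_nth: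
  fixes \<phi> :: "complex \<Rightarrow> complex^'p^'p"
  assumes eps: "\<epsilon> > 0" and z: "z \<noteq> 0"
  shows "(\<phi> z + z\<^sup>2 *\<^sub>C (\<Sum>n=0..N. weyl_series_term \<phi> \<epsilon> z n)) $ b $ a
    = z\<^sup>2 * sampling_error \<epsilon> z N (\<lambda>\<zeta>. \<phi> \<zeta> $ b $ a / \<zeta>\<^sup>2)"
proof -
  have node: "of_real ((real q + \<epsilon>) powi (-2) * a_coeff n q) * p
      = - (of_real (a_coeff n q) * (p / (\<i> * of_nat q + \<i> * of_real \<epsilon>)\<^sup>2))" for n q p
  proof -
    have "(\<i> * of_nat q + \<i> * of_real \<epsilon>)\<^sup>2 = - (of_real (real q + \<epsilon>) ^ 2)"
      by (simp add: power2_eq_square algebra_simps)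
    then show ?thesis by (simp add: power_int_def divide_inverse power_inverse mult_ac)
  qed
  have "(weyl_series_term \<phi> \<epsilon> z n) $ b $ a = - (c_coeff n (z + \<i> / 2 - \<i> * of_real \<epsilon>) *
    (\<Sum>q=0..n. of_real (a_coeff n q) * (\<phi> (\<i> * of_nat q + \<i> * of_real \<epsilon>) $ b $ a / (\<i> * of_nat q + \<i> * of_real \<epsilon>)\<^sup>2)))" for n
    by (simp add: weyl_series_term_def cscale_nth scaleR_conv_of_real[where 'a=complex] node sum_negf
        del: of_real_mult)
  then show ?thesis
    using z by (simp add: sampling_error_def cscale_nth sum_negf right_diff_distrib)
qed

lemma norm_matrix_le_sum_entries:
  fixes A :: "complex^'n^'m"
  shows "norm A \<le> (\<Sum>i\<in>UNIV. \<Sum>j\<in>UNIV. norm (A $ i $ j))"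
proof -
  have "norm A \<le> (\<Sum>i\<in>UNIV. norm (A $ i))"
    unfolding norm_vec_def[of A] by (rule L2_set_le_sum) simp
  also have "\<dots> \<le> (\<Sum>i\<in>UNIV. \<Sum>j\<in>UNIV. norm (A $ i $ j))"
    by (intro sum_mono) (simp add: norm_vec_def[of "A $ _"] L2_set_le_sum)
  finally show ?thesis .
qed

theorem theorem5p2:
  fixes v :: "real \<Rightarrow> complex^'p^'p"
    and \<phi> :: "complex \<Rightarrow> complex^'p^'p"
    and \<epsilon> :: real
    and z :: complex
  assumes v_meas: "v \<in> borel_measurable (lebesgue_on {0..})"
    and v_bdd: "\<forall>l>0. bdd_above ((\<lambda>x. norm (v x)) ` {0<..<l})"
    and weyl: "weyl_function v \<phi>"
    and eps: "\<epsilon> > 0"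
    and z: "Im z > 1/2 + \<epsilon>"
  shows "summable (weyl_series_term \<phi> \<epsilon> z) \<and>
         \<phi> z = - (z\<^sup>2 *\<^sub>C (\<Sum>n. weyl_series_term \<phi> \<epsilon> z n)) \<and>
         (\<lambda>N. norm (\<phi> z + z\<^sup>2 *\<^sub>C (\<Sum>n=0..N. weyl_series_term \<phi> \<epsilon> z n)))
           \<in> O(\<lambda>N. real N powr (1/2 + \<epsilon> - Im z))"
proof -
  have z0: "z \<noteq> 0" using z eps by auto
  define D where "D = (\<lambda>N. \<phi> z + z\<^sup>2 *\<^sub>C (\<Sum>n=0..N. weyl_series_term \<phi> \<epsilon> z n))"
  have entry: "(\<lambda>N. norm (D N $ b $ a)) \<in> O(\<lambda>N. real N powr (1/2 + \<epsilon> - Im z))" for b a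
    unfolding D_def weyl_partial_sum_error_nth[OF eps z0] norm_mult
    by (rule landau_o.big.cmult_in_iff[THEN iffD2]) (use sampling_error_weyl_entry_bigo[OF weyl eps z] z0 in auto)
  have "(\<lambda>N. \<Sum>b\<in>UNIV. \<Sum>a\<in>UNIV. norm (D N $ b $ a)) \<in> O(\<lambda>N. real N powr (1/2 + \<epsilon> - Im z))"
    by (intro big_sum_in_bigo entry)
  then have D_bigo: "(\<lambda>N. norm (D N)) \<in> O(\<lambda>N. real N powr (1/2 + \<epsilon> - Im z))"
    by (rule landau_o.big_trans[rotated])
       (auto intro!: bigoI[of _ 1] always_eventually norm_matrix_le_sum_entries simp: sum_nonneg)
  have rate: "(\<lambda>N. real N powr (1/2 + \<epsilon> - Im z)) \<longlonglongrightarrow> 0"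
    using z by (intro tendsto_neg_powr filterlim_real_sequentially) auto
  obtain c where c: "\<forall>\<^sub>F N in sequentially. norm (norm (D N)) \<le> c * norm (real N powr (1/2 + \<epsilon> - Im z))"
    using D_bigo by (rule landau_o.bigE)
  have "(\<lambda>N. norm (D N)) \<longlonglongrightarrow> 0"
    by (rule tendsto_0_le[OF rate, of _ c]) (use c in \<open>simp add: mult.commute\<close>)
  then have "D \<longlonglongrightarrow> 0" by (simp only: tendsto_norm_zero_iff)
  moreover have lin: "bounded_linear (\<lambda>A :: complex^'p^'p. k *\<^sub>C A)" for k
    by (subst linear_conv_bounded_linear[symmetric])
       (auto intro!: linearI simp: vec_eq_iff cscale_nth algebra_simps)
  ultimately have "(\<lambda>N. (1 / z\<^sup>2) *\<^sub>C (D N - \<phi> z)) \<longlonglongrightarrow> (1 / z\<^sup>2) *\<^sub>C (0 - \<phi> z)"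
    by (intro bounded_linear.tendsto[OF lin] tendsto_diff tendsto_const)
  moreover have "(1 / z\<^sup>2) *\<^sub>C (D N - \<phi> z) = (\<Sum>n\<le>N. weyl_series_term \<phi> \<epsilon> z n)" for N
    using z0 by (simp add: D_def vec_eq_iff cscale_nth atLeast0AtMost)
  ultimately have sums: "weyl_series_term \<phi> \<epsilon> z sums ((1 / z\<^sup>2) *\<^sub>C (0 - \<phi> z))"
    by (simp add: sums_def_le)
  have "\<phi> z = - (z\<^sup>2 *\<^sub>C ((1 / z\<^sup>2) *\<^sub>C (0 - \<phi> z)))"
    using z0 by (simp add: vec_eq_iff cscale_nth)
  then show ?thesis
    using sums_summable[OF sums] sums_unique[OF sums] D_bigo unfolding D_def by simp
qed

end
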